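(* Let $\vec c=(c_1,\dots,c_k)$ be a composition of $n$ with $c_k>0$. The cycles $g_\alpha=\sum_{\gamma\in\mathfrak S^c_{\vec c}}(-1)^{\gamma}\,\sigma(\alpha\circ\gamma,\vec c)$, where $\alpha$ ranges over all permutations in $\mathfrak S_n$ with descent composition $\vec c$, form a basis for the homology group $\widetilde H_{k-2}(\Delta_{\vec c})$.
   Context: A pointed composition of $n$ is $(c_1,\dots,c_k)$ with $c_1,\dots,c_{k-1}\ge1$, $c_k\ge0$, sum $n$, ordered by $\vec c\le\vec d$ iff $\vec d$ is obtained from $\vec c$ by replacing runs of consecutive entries by their sums. An ordered set partition of $[n]$ is $(C_1,\dots,C_r)$, pairwise disjoint with union $[n]$, $C_1,\dots,C_{r-1}$ nonempty, $C_r$ possibly empty; type $(|C_1|,\dots,|C_r|)$. $\Delta_n$ is the simplicial complex with these faces ($(C_1,\dots,C_r)$ of dimension $r-2$, faces obtained by merging consecutive blocks, $([n])$ the empty face), and $\Delta_{\vec c}=\{\tau\in\Delta_n:\vec c\le\operatorname{type}(\tau)\}$. The chain group $C_j(\Delta_{\vec c})$ is free on the faces of dimension $j$, with boundary $\partial(C_1,\dots,C_r)=\sum_{i=1}^{r-1}(-1)^{i-1}(C_1,\dots,C_i\cup C_{i+1},\dots,C_r)$; $\widetilde H$ is reduced homology (coefficients in a fixed field). For $\alpha=\alpha_1\cdots\alpha_n$, $\sigma(\alpha,\vec c)=(\{\alpha_j:j\in R_1\},\dots,\{\alpha_j:j\in R_k\})$ with $R_i=[c_1+\dots+c_{i-1}+1,c_1+\dots+c_i]$;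 $\alpha\circ\gamma$ is $j\mapsto\alpha_{\gamma(j)}$; $(-1)^\gamma$ is the sign of $\gamma$. The descent composition of $\alpha$ with descent set $\{i:\alpha_i>\alpha_{i+1}\}=\{s_1<\dots<s_{k-1}\}$ is $(s_1,s_2-s_1,\dots,n-s_{k-1})$. The column intervals $K_1,\dots,K_{n-k+1}$ of $\vec c$ are the maximal intervals of $[n]$ such that $j$ and $j+1$ lie in the same interval iff $j\in\{c_1,c_1+c_2,\dots,c_1+\dots+c_{k-1}\}$; $\mathfrak S^c_{\vec c}=\mathfrak S_{K_1}\times\cdots\times\mathfrak S_{K_{n-k+1}}$. *)

theory Defs
  imports
    "Jordan_Normal_Form.VS_Connect"
    "HOL-Algebra.AbelCoset"
    "HOL-Library.Poly_Mapping"
begin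

section \<open>Pointed compositions and ordered set partitions\<close>

definition pointed_composition :: "nat \<Rightarrow> nat list \<Rightarrow> bool" where
  "pointed_composition n c \<longleftrightarrow>
     c \<noteq> [] \<and> (\<forall>x\<in>set (butlast c). x \<ge> 1) \<and> sum_list c = n"

definition pcomp_le :: "nat list \<Rightarrow> nat list \<Rightarrow> bool" where
  "pcomp_le c d \<longleftrightarrow>
     (\<exists>runs. [] \<notin> set runs \<and> concat runs = c \<and> map sum_list runs = d)"

definition ordered_set_partition :: "nat \<Rightarrow> nat set list \<Rightarrow> bool" where
  "ordered_set_partition n C \<longleftrightarrow>
     C \<noteq> [] \<and> \<Union>(set C) = {1..n} \<and> {} \<notin> set (butlast C) \<and>
     (\<forall>i<length C. \<forall>j<length C. i \<noteq> j \<longrightarrow> C ! i \<inter> C ! j = {})"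

definition osp_type :: "nat set list \<Rightarrow> nat list" where
  "osp_type C = map card C"

section \<open>The complexes\<close>

definition Delta :: "nat \<Rightarrow> nat set list set" where
  "Delta n = {C. ordered_set_partition n C}"

definition Delta_comp :: "nat \<Rightarrow> nat list \<Rightarrow> nat set list set" where
  "Delta_comp n c = {C \<in> Delta n. pcomp_le c (osp_type C)}"

definition face_dim :: "nat set list \<Rightarrow> int" where
  "face_dim C = int (length C) - 2"

section \<open>Chains and reduced homology with coefficients in a field\<close>

text \<open>
  A chain is a finitely supported function from ordered set partitions to the field.  The face
  with one block is the empty face, of dimension \<open>-1\<close>, and it belongs to the complexes above;
  the homology below is therefore the reduced one.
\<close>

type_synonym 'f chain = "nat set list \<Rightarrow>\<^sub>0 'f"

abbreviation chain_scale :: "'f::field \<Rightarrow> 'f chain \<Rightarrow> 'f chain" where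
  "chain_scale a x \<equiv> Poly_Mapping.map ((*) a) x"

definition chains :: "nat set list set \<Rightarrow> int \<Rightarrow> 'f::field chain set" where
  "chains X j = {x. Poly_Mapping.keys x \<subseteq> {C \<in> X. face_dim C = j}}"

text \<open>Block indices start at \<open>0\<close> here, so the \<open>i\<close>-th merge carries the sign \<open>(-1)\<^sup>i\<close>.\<close>

definition merge_blocks :: "nat \<Rightarrow> nat set list \<Rightarrow> nat set list" where
  "merge_blocks i C = take i C @ [C ! i \<union> C ! Suc i] @ drop (i + 2) C"

definition face_boundary :: "nat set list \<Rightarrow> 'f::field chain" where
  "face_boundary C =
     (\<Sum>i<length C - 1. Poly_Mapping.single (merge_blocks i C) ((- 1) ^ i))"

definition boundary :: "'f::field chain \<Rightarrow> 'f chain" where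
  "boundary x =
     (\<Sum>C\<in>Poly_Mapping.keys x. chain_scale (Poly_Mapping.lookup x C) (face_boundary C))"

definition cycles :: "nat set list set \<Rightarrow> int \<Rightarrow> 'f::field chain set" where
  "cycles X j = {x \<in> chains X j. boundary x = 0}"

definition boundaries :: "nat set list set \<Rightarrow> int \<Rightarrow> 'f::field chain set" where
  "boundaries X j = boundary ` chains X (j + 1)"

text \<open>
  The module record extends the ring record; its multiplicative fields play no role in the
  theory of modules and are filled arbitrarily.
\<close>

definition cycle_space :: "nat set list set \<Rightarrow> int \<Rightarrow> ('f::field, 'f chain) module" where
  "cycle_space X j =
     \<lparr>carrier = cycles X j, mult = (\<lambda>_ _. 0), one = 0, zero = 0, add = (+),
      smult = chain_scale\<rparr>"

definition quotient_module ::
  "('a, 'b, 'm) module_scheme \<Rightarrow> 'b set \<Rightarrow> ('a, 'b set) module" where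
  "quotient_module M N =
     \<lparr>carrier = a_rcosets\<^bsub>M\<^esub> N, mult = (\<lambda>_ _. N), one = N, zero = N, add = set_add M,
      smult = (\<lambda>a Y. \<Union>x\<in>Y. N +>\<^bsub>M\<^esub> (a \<odot>\<^bsub>M\<^esub> x))\<rparr>"

definition homology ::
  "nat set list set \<Rightarrow> int \<Rightarrow> ('f::field, 'f chain set) module" where
  "homology X j = quotient_module (cycle_space X j) (boundaries X j)"

definition homology_class ::
  "nat set list set \<Rightarrow> int \<Rightarrow> 'f::field chain \<Rightarrow> 'f chain set" where
  "homology_class X j z = boundaries X j +>\<^bsub>cycle_space X j\<^esub> z"

section \<open>Permutations and the chains attached to them\<close>

text \<open>A permutation of \<open>[n]\<close> is a function \<open>\<alpha>\<close> on the naturals with \<open>\<alpha> permutes {1..n}\<close>.\<close>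

definition descent_set :: "nat \<Rightarrow> (nat \<Rightarrow> nat) \<Rightarrow> nat set" where
  "descent_set n \<alpha> = {i \<in> {1..<n}. \<alpha> i > \<alpha> (i + 1)}"

definition descent_composition :: "nat \<Rightarrow> (nat \<Rightarrow> nat) \<Rightarrow> nat list" where
  "descent_composition n \<alpha> =
     (let s = sorted_list_of_set (descent_set n \<alpha>) in map2 (-) (s @ [n]) (0 # s))"

definition position_block :: "nat list \<Rightarrow> nat \<Rightarrow> nat set" where
  "position_block c i = {sum_list (take i c) + 1 .. sum_list (take (Suc i) c)}"

definition osp_of_perm :: "(nat \<Rightarrow> nat) \<Rightarrow> nat list \<Rightarrow> nat set list" where
  "osp_of_perm \<alpha> c = map (\<lambda>i. \<alpha> ` position_block c i) [0..<length c]"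

definition partial_sums :: "nat list \<Rightarrow> nat set" where
  "partial_sums c = (\<lambda>i. sum_list (take i c)) ` {1..<length c}"

definition linked_intervals :: "nat \<Rightarrow> nat list \<Rightarrow> nat set set" where
  "linked_intervals n c =
     {{a..b} | a b. 1 \<le> a \<and> a \<le> b \<and> b \<le> n \<and> (\<forall>j\<in>{a..<b}. j \<in> partial_sums c)}"

definition column_intervals :: "nat \<Rightarrow> nat list \<Rightarrow> nat set set" where
  "column_intervals n c =
     {K \<in> linked_intervals n c. \<forall>L\<in>linked_intervals n c. K \<subseteq> L \<longrightarrow> K = L}"

text \<open>The product of the symmetric groups of the column intervals, as a subgroup of the
  symmetric group on \<open>[n]\<close>.\<close>

definition column_group :: "nat \<Rightarrow> nat list \<Rightarrow> (nat \<Rightarrow> nat) set" where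
  "column_group n c =
     {\<gamma>. \<gamma> permutes {1..n} \<and> (\<forall>K\<in>column_intervals n c. \<gamma> ` K = K)}"

definition perm_cycle :: "nat \<Rightarrow> nat list \<Rightarrow> (nat \<Rightarrow> nat) \<Rightarrow> 'f::field chain" where
  "perm_cycle n c \<alpha> =
     (\<Sum>\<gamma>\<in>column_group n c.
        Poly_Mapping.single (osp_of_perm (\<alpha> \<circ> \<gamma>) c) (of_int (sign \<gamma>)))"

definition perms_with_descents :: "nat \<Rightarrow> nat list \<Rightarrow> (nat \<Rightarrow> nat) set" where
  "perms_with_descents n c = {\<alpha>. \<alpha> permutes {1..n} \<and> descent_composition n \<alpha> = c}"

section \<open>Homology is a vector space\<close>

lemma lookup_chain_scale [simp]:
  "Poly_Mapping.lookup (chain_scale a x) C = a * Poly_Mapping.lookup x C"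
  by (simp add: Poly_Mapping.map.rep_eq when_def)

lemma chain_scale_simps:
  fixes x y :: "'f::field chain"
  shows "chain_scale a (x + y) = chain_scale a x + chain_scale a y"
    and "chain_scale (a + b) x = chain_scale a x + chain_scale b x"
    and "chain_scale (a * b) x = chain_scale a (chain_scale b x)"
    and "chain_scale 1 x = x"
    and "chain_scale 0 x = 0"
    and "chain_scale a 0 = (0 :: 'f chain)"
  by (auto intro!: poly_mapping_eqI simp: lookup_add algebra_simps)

lemma chain_scale_sum:
  "chain_scale a (\<Sum>i\<in>I. f i) = (\<Sum>i\<in>I. chain_scale a (f i))"
  by (induction I rule: infinite_finite_induct) (auto simp: chain_scale_simps)

lemma boundary_superset:
  assumes "finite S" "Poly_Mapping.keys x \<subseteq> S"
  shows "boundary x = (\<Sum>C\<in>S. chain_scale (Poly_Mapping.lookup x C) (face_boundary C))"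
  unfolding boundary_def
  by (rule sum.mono_neutral_left) (use assms in \<open>auto simp: in_keys_iff chain_scale_simps\<close>)

lemma boundary_add: "boundary (x + y) = boundary x + boundary y"
proof -
  let ?S = "Poly_Mapping.keys x \<union> Poly_Mapping.keys y"
  have "Poly_Mapping.keys (x + y) \<subseteq> ?S" by (rule keys_add)
  then show ?thesis
    by (subst (1 2 3) boundary_superset[of ?S])
       (auto simp: lookup_add chain_scale_simps sum.distrib)
qed

lemma boundary_scale: "boundary (chain_scale a x) = chain_scale a (boundary x)"
proof -
  have "Poly_Mapping.keys (chain_scale a x) \<subseteq> Poly_Mapping.keys x"
    by (auto simp: in_keys_iff)
  then show ?thesis
    by (subst (1 2) boundary_superset[of "Poly_Mapping.keys x"])
       (auto simp: chain_scale_sum chain_scale_simps)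
qed

lemma chains_closed:
  "0 \<in> chains X j"
  "x \<in> chains X j \<Longrightarrow> y \<in> chains X j \<Longrightarrow> x + y \<in> chains X j"
  "x \<in> chains X j \<Longrightarrow> chain_scale a x \<in> chains X j"
  unfolding chains_def using keys_add[of x y] by (auto simp: in_keys_iff)

lemma boundary_zero: "boundary 0 = 0"
  by (simp add: boundary_def)

lemma cycles_closed:
  "0 \<in> cycles X j"
  "x \<in> cycles X j \<Longrightarrow> y \<in> cycles X j \<Longrightarrow> x + y \<in> cycles X j"
  "x \<in> cycles X j \<Longrightarrow> chain_scale a x \<in> cycles X j"
  by (auto simp: cycles_def chains_closed boundary_add boundary_scale boundary_zero chain_scale_simps)

lemma boundaries_closed:
  "0 \<in> boundaries X j"
  "x \<in> boundaries X j \<Longrightarrow> y \<in> boundaries X j \<Longrightarrow> x + y \<in> boundaries X j"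
  "x \<in> boundaries X j \<Longrightarrow> chain_scale a x \<in> boundaries X j"
  unfolding boundaries_def
  by (force simp: boundary_zero chains_closed intro: image_eqI[of _ _ 0],
      force simp: chains_closed simp flip: boundary_add,
      force simp: chains_closed simp flip: boundary_scale)

lemma homology_class_eq: "homology_class X j z = {b + z | b. b \<in> boundaries X j}"
  by (auto simp: homology_class_def cycle_space_def a_r_coset_def r_coset_def)

lemma homology_carrier: "carrier (homology X j) = homology_class X j ` cycles X j"
  by (auto simp: homology_def quotient_module_def A_RCOSETS_def RCOSETS_def homology_class_def
      a_r_coset_def cycle_space_def)

lemma homology_zero: "\<zero>\<^bsub>homology X j\<^esub> = homology_class X j 0"
  by (auto simp: homology_class_eq homology_def quotient_module_def)

lemma homology_add:
  "homology_class X j x \<oplus>\<^bsub>homology X j\<^esub> homology_class X j y = homology_class X j (x + y)"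
proof -
  have "\<exists>b b'. b + (x + y) = c + x + (c' + y) \<and> b \<in> boundaries X j"
    if "c \<in> boundaries X j" "c' \<in> boundaries X j" for c c'
    by (rule exI[of _ "c + c'"]) (use that in \<open>simp add: boundaries_closed algebra_simps\<close>)
  moreover have "\<exists>c c'. b + (x + y) = c + x + (c' + y) \<and> c \<in> boundaries X j \<and> c' \<in> boundaries X j"
    if "b \<in> boundaries X j" for b
    by (rule exI[of _ b], rule exI[of _ 0])
       (use that in \<open>simp add: boundaries_closed algebra_simps\<close>)
  ultimately show ?thesis
    unfolding homology_class_eq
    by (fastforce simp: homology_def quotient_module_def set_add_def set_mult_def cycle_space_def)
qed

lemma homology_smult:
  "a \<odot>\<^bsub>homology X j\<^esub> homology_class X j x = homology_class X j (chain_scale a x)"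
proof -
  have eq: "a \<odot>\<^bsub>homology X j\<^esub> homology_class X j x =
      (\<Union>b\<in>boundaries X j. homology_class X j (chain_scale a (b + x)))"
    by (auto simp: homology_class_eq homology_def quotient_module_def cycle_space_def
        a_r_coset_def r_coset_def)
  have "homology_class X j (chain_scale a (b + x)) \<subseteq> homology_class X j (chain_scale a x)"
    if "b \<in> boundaries X j" for b
  proof -
    have "\<exists>b''. b' + chain_scale a (b + x) = b'' + chain_scale a x \<and> b'' \<in> boundaries X j"
      if "b' \<in> boundaries X j" for b'
      by (rule exI[of _ "b' + chain_scale a b"])
         (use that \<open>b \<in> _\<close> in \<open>simp add: boundaries_closed chain_scale_simps algebra_simps\<close>)
    then show ?thesis
      by (auto simp: homology_class_eq)
  qed
  moreover have "homology_class X j (chain_scale a (0 + x)) = homology_class X j (chain_scale a x)"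
    by simp
  ultimately show ?thesis
    unfolding eq using boundaries_closed(1)[of X j] by blast
qed

lemma vectorspace_homology:
  "vectorspace (class_ring :: 'f::field ring) (homology X j :: ('f, 'f chain set) module)"
proof -
  let ?H = "homology X j :: ('f, 'f chain set) module"
  have "abelian_group ?H"
  proof (rule abelian_groupI)
    fix Y assume "Y \<in> carrier ?H"
    then obtain x where x: "x \<in> cycles X j" "Y = homology_class X j x"
      by (auto simp: homology_carrier)
    have "chain_scale (- 1) x + x = chain_scale (- 1 + 1) x"
      by (simp only: chain_scale_simps)
    then have "chain_scale (- 1) x + x = 0"
      by (simp add: chain_scale_simps)
    then have "homology_class X j (chain_scale (- 1) x) \<oplus>\<^bsub>?H\<^esub> Y = \<zero>\<^bsub>?H\<^esub>"
      by (simp add: x homology_add homology_zero)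
    then show "\<exists>Z\<in>carrier ?H. Z \<oplus>\<^bsub>?H\<^esub> Y = \<zero>\<^bsub>?H\<^esub>"
      using x by (auto simp: homology_carrier cycles_closed)
  qed (auto simp: homology_carrier homology_add homology_zero cycles_closed algebra_simps)
  then have "module (class_ring :: 'f ring) ?H"
    by (intro Module.module.intro class_cring.is_cring module_axioms.intro)
       (auto simp: homology_carrier homology_add homology_smult cycles_closed
          chain_scale_simps)
  moreover have "field (class_ring :: 'f ring)"
    by unfold_locales
  ultimately show ?thesis
    by (simp add: vectorspace_def)
qed

end

theory Submission
  imports Defs
begin

text \<open>
  In degree \<open>k - 2\<close> the complex has no higher faces, so the homology is the space of cycles
  on the faces of type exactly \<open>c\<close>. Since all parts are positive, the merges at different places
  have different types and the cycle condition splits into one condition per place.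

  Order the faces by \<open>weight (C\<^sub>0, C\<^sub>1, \<dots>) = (\<Sum>i. i * \<Sum>C\<^sub>i)\<close>. If \<open>\<gamma> \<noteq> id\<close> is in the column
  group, then \<open>\<alpha> \<circ> \<gamma>\<close> has an ascent across some row boundary, and swapping it lowers the weight.
  So \<open>\<sigma>(\<alpha>, c)\<close> is the unique face of least weight in \<open>g\<^sub>\<alpha>\<close>; this gives unitriangularity,
  hence independence. Conversely, a face that is not \<open>\<sigma>(\<alpha>, c)\<close> for any \<open>\<alpha>\<close> with descent
  composition \<open>c\<close> has adjacent blocks with all of \<open>C\<^sub>i\<close> below all of \<open>C\<^sub>i\<^sub>+\<^sub>1\<close>. It is then the
  heaviest among the faces with the same merge at \<open>i\<close>, and the cycle condition expresses its
  coefficient by those of lighter faces. A cycle vanishing on all \<open>\<sigma>(\<alpha>, c)\<close> is therefore zero,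
  which gives spanning.
\<close>

section \<open>Rows of a ribbon shape\<close>

text \<open>Positivity of all parts makes the partial sums strictly increasing, so blocks of
  positions are nonempty and merges at different places can be told apart by type.\<close>

locale positive_composition =
  fixes n :: nat and c :: "nat list"
  assumes nonempty: "c \<noteq> []"
    and parts_pos: "\<And>x. x \<in> set c \<Longrightarrow> 0 < x"
    and sum_parts: "sum_list c = n"
begin

definition psum :: "nat \<Rightarrow> nat" where
  "psum i = sum_list (take i c)"

text \<open>For a position \<open>p\<close> in \<open>{1..n}\<close>, the index, from
  \<open>0\<close>, of its row in the ribbon. Counting the row ends before \<open>p\<close> shows at
  once that the index rises only from a partial sum to its successor.\<close>

definition row :: "nat \<Rightarrow> nat" where
  "row p = card {s \<in> partial_sums c. s < p}"

definition facets :: "nat set list set" where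
  "facets = {C. ordered_set_partition n C \<and> osp_type C = c}"

section \<open>Partial sums, rows and blocks of positions\<close>

lemma psum_0 [simp]: "psum 0 = 0"
  by (simp add: psum_def)

lemma psum_length [simp]: "psum (length c) = n"
  by (simp add: psum_def sum_parts)

lemma psum_Suc: "i < length c \<Longrightarrow> psum (Suc i) = psum i + c ! i"
  by (simp add: psum_def take_Suc_conv_app_nth)

lemma psum_strict_mono:
  assumes "i < j" "j \<le> length c"
  shows "psum i < psum j"
  using assms
proof (induction j)
  case (Suc j)
  then have "0 < c ! j"
    by (intro parts_pos) simp
  then have "psum j < psum (Suc j)"
    using Suc.prems by (simp add: psum_Suc)
  with Suc show ?case
    by (cases "i = j") auto
qed simp

lemma psum_less_iff: "i \<le> length c \<Longrightarrow> j \<le> length c \<Longrightarrow> psum i < psum j \<longleftrightarrow> i < j"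
  using psum_strict_mono by (metis linorder_neqE_nat order_less_asym)

lemma psum_le_iff: "i \<le> length c \<Longrightarrow> j \<le> length c \<Longrightarrow> psum i \<le> psum j \<longleftrightarrow> i \<le> j"
  using psum_less_iff[of j i] by linarith

lemma inj_on_psum: "inj_on psum {..length c}"
  by (rule inj_onI) (metis atMost_iff order_antisym order_refl psum_le_iff)

lemma position_block_psum: "position_block c i = {psum i<..psum (Suc i)}"
  by (auto simp: position_block_def psum_def)

lemma card_position_block: "i < length c \<Longrightarrow> card (position_block c i) = c ! i"
  by (simp add: position_block_psum psum_Suc)

lemma partial_sums_psum: "partial_sums c = psum ` {1..<length c}"
  by (simp add: partial_sums_def psum_def)

lemma partial_sums_subset: "partial_sums c \<subseteq> {1..<n}"
  unfolding partial_sums_psum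
  using psum_strict_mono[of 0] psum_strict_mono[of _ "length c"] by (force simp: Suc_le_eq)

lemma finite_partial_sums [simp]: "finite (partial_sums c)"
  by (simp add: partial_sums_psum)

lemma row_position_block:
  assumes i: "i < length c" and p: "p \<in> position_block c i"
  shows "row p = i"
proof -
  have "psum j < p \<longleftrightarrow> j \<le> i" if "j < length c" for j
    using p psum_le_iff[of j i] psum_le_iff[of "Suc i" j] i that
    by (auto simp: position_block_psum)
  then have "{s \<in> partial_sums c. s < p} = psum ` {1..i}"
    using i by (auto simp: partial_sums_psum)
  moreover have "inj_on psum {1..i}"
    by (rule inj_on_subset[OF inj_on_psum]) (use i in auto)
  ultimately show ?thesis
    by (simp add: row_def card_image)
qed

lemma ex_position_block:
  assumes "p \<in> {1..n}"
  shows "\<exists>i<length c. p \<in> position_block c i"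
proof -
  \<comment> \<open>The least partial sum reaching \<open>p\<close> is the right end of its block;
    it is not \<open>psum 0 = 0\<close> because \<open>p\<close> is positive, so it has a
    predecessor below \<open>p\<close>.\<close>
  define j where "j = (LEAST j. p \<le> psum j)"
  have "p \<le> psum (length c)"
    using assms by simp
  then have j: "p \<le> psum j" "j \<le> length c"
    unfolding j_def by (rule LeastI, rule Least_le)
  then obtain i where i: "j = Suc i"
    using assms by (cases j) auto
  then have "psum i < p"
    using not_less_Least[of i "\<lambda>j. p \<le> psum j"] unfolding j_def[symmetric] by auto
  then have "i < length c" "p \<in> position_block c i"
    using i j by (auto simp: position_block_psum)
  then show ?thesis
    by blast
qed

lemma position_block_row:
  assumes "p \<in> {1..n}"
  shows "p \<in> position_block c (row p)" "row p < length c"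
  using ex_position_block[OF assms] row_position_block by blast+

lemma position_block_subset: "i < length c \<Longrightarrow> position_block c i \<subseteq> {1..n}"
  using psum_le_iff[of "Suc i" "length c"] by (auto simp: position_block_psum)

text \<open>Blocks as fibres of \<open>row\<close>: disjointness and the regrouping of sums by rows
  both come from this form.\<close>

lemma position_block_eq:
  assumes "i < length c"
  shows "position_block c i = {p \<in> {1..n}. row p = i}"
  using assms position_block_row position_block_subset row_position_block by blast

lemma row_Suc:
  assumes "p \<in> partial_sums c"
  shows "row (Suc p) = Suc (row p)"
proof -
  have "{s \<in> partial_sums c. s < Suc p} = insert p {s \<in> partial_sums c. s < p}"
    using assms by auto
  then show ?thesis
    by (simp add: row_def)
qed

lemma row_Suc_eq:
  assumes "p \<notin> partial_sums c"
  shows "row (Suc p) = row p"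
proof -
  have "{s \<in> partial_sums c. s < Suc p} = {s \<in> partial_sums c. s < p}"
    using assms by (auto simp: less_Suc_eq)
  then show ?thesis
    by (simp add: row_def)
qed

lemma row_psum:
  assumes "Suc i < length c"
  shows "row (psum (Suc i)) = i"
  using assms psum_strict_mono[of i "Suc i"]
  by (intro row_position_block) (auto simp: position_block_psum)

lemma psum_Suc_in_partial_sums: "Suc i < length c \<Longrightarrow> psum (Suc i) \<in> partial_sums c"
  by (auto simp: partial_sums_psum)

section \<open>Faces of type exactly \<open>c\<close>\<close>

lemma length_osp_of_perm [simp]: "length (osp_of_perm \<alpha> c) = length c"
  by (simp add: osp_of_perm_def)

lemma nth_osp_of_perm [simp]: "i < length c \<Longrightarrow> osp_of_perm \<alpha> c ! i = \<alpha> ` position_block c i"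
  by (simp add: osp_of_perm_def)

lemma osp_of_perm_facet:
  assumes "\<alpha> permutes {1..n}"
  shows "osp_of_perm \<alpha> c \<in> facets"
proof -
  let ?C = "osp_of_perm \<alpha> c"
  have inj: "inj \<alpha>"
    using assms by (rule permutes_inj)
  have "osp_type ?C = c"
    by (rule nth_equalityI)
      (simp_all add: osp_type_def card_image inj_on_subset[OF inj] card_position_block)
  moreover have "\<Union>(set ?C) = {1..n}"
  proof -
    have "\<Union>(set ?C) = \<alpha> ` (\<Union>i<length c. position_block c i)"
      by (simp add: osp_of_perm_def image_UN lessThan_atLeast0)
    also have "(\<Union>i<length c. position_block c i) = {1..n}"
      using position_block_subset ex_position_block by blast
    finally show ?thesis
      using permutes_image[OF assms] by simp
  qed
  moreover have "{} \<notin> set ?C"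
    using psum_strict_mono by (auto simp: osp_of_perm_def position_block_psum)
  then have "{} \<notin> set (butlast ?C)"
    by (meson in_set_butlastD)
  moreover have "?C ! i \<inter> ?C ! j = {}" if "i < length c" "j < length c" "i \<noteq> j" for i j
    using that by (auto simp: position_block_eq dest: injD[OF inj])
  ultimately show ?thesis
    using nonempty by (auto simp: facets_def ordered_set_partition_def osp_of_perm_def)
qed

lemma facet_length: "C \<in> facets \<Longrightarrow> length C = length c"
  by (auto simp: facets_def osp_type_def)

lemma facet_card: "C \<in> facets \<Longrightarrow> i < length c \<Longrightarrow> card (C ! i) = c ! i"
  by (auto simp: facets_def osp_type_def)

lemma facet_Union: "C \<in> facets \<Longrightarrow> \<Union>(set C) = {1..n}"
  by (simp add: facets_def ordered_set_partition_def)

lemma facet_subset: "C \<in> facets \<Longrightarrow> i < length c \<Longrightarrow> C ! i \<subseteq> {1..n}"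
  using facet_Union facet_length by (metis Union_upper nth_mem)

lemma facet_finite: "C \<in> facets \<Longrightarrow> i < length c \<Longrightarrow> finite (C ! i)"
  using facet_subset finite_subset by blast

lemma facet_disjoint:
  "C \<in> facets \<Longrightarrow> i < length c \<Longrightarrow> j < length c \<Longrightarrow> i \<noteq> j \<Longrightarrow> C ! i \<inter> C ! j = {}"
  by (simp add: facets_def ordered_set_partition_def osp_type_def) (metis length_map)

lemma finite_facets: "finite facets"
proof (rule finite_subset)
  show "facets \<subseteq> {C. set C \<subseteq> Pow {1..n} \<and> length C = length c}"
    using facet_length facet_Union by blast
  show "finite {C. set C \<subseteq> Pow {1..n} \<and> length C = length c}"
    by (rule finite_lists_length_eq) simp
qed

end

section \<open>Descents and the column group\<close>

text \<open>Telescoping; sortedness keeps the truncated subtraction of naturals exact. The list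
  padded with \<open>0\<close> in front and \<open>n\<close> at the end holds the partial sums at
  all indices.\<close>

lemma sum_list_take_differences:
  fixes s :: "nat list"
  assumes s: "sorted_wrt (<) (s @ [n])" and i: "i \<le> Suc (length s)"
  shows "sum_list (take i (map2 (-) (s @ [n]) (0 # s))) = (0 # s @ [n]) ! i"
  using i
proof (induction i)
  case (Suc i)
  have "(0 # s) ! i \<le> (s @ [n]) ! i"
  proof (cases i)
    case (Suc m)
    then show ?thesis
      using sorted_wrt_nth_less[OF s, of m i] Suc.prems by (simp add: nth_append)
  qed simp
  moreover have "(0 # s) ! i = (0 # s @ [n]) ! i"
    using Suc.prems by (cases i) (simp_all add: nth_append)
  ultimately show ?case
    using Suc by (simp add: take_Suc_conv_app_nth)
qed simp

text \<open>\<open>partial_sums\<close> omits the empty and the full prefix, which removes exactly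
  the padding \<open>0\<close> and \<open>n\<close>.\<close>

lemma partial_sums_differences:
  fixes s :: "nat list"
  assumes "sorted_wrt (<) (s @ [n])"
  shows "partial_sums (map2 (-) (s @ [n]) (0 # s)) = set s"
proof -
  have "partial_sums (map2 (-) (s @ [n]) (0 # s)) = (\<lambda>i. (0 # s @ [n]) ! i) ` {1..length s}"
    unfolding partial_sums_def
    by (rule image_cong) (use sum_list_take_differences[OF assms] in auto)
  also have "\<dots> = (!) s ` {0..<length s}"
    by (auto simp: image_image nth_append simp flip: image_Suc_atLeastLessThan
        atLeastLessThanSuc_atLeastAtMost)
  also have "\<dots> = set s"
    by (metis list.set_map map_nth set_upt)
  finally show ?thesis .
qed

lemma partial_sums_descent_composition: "partial_sums (descent_composition n \<alpha>) = descent_set n \<alpha>"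
proof -
  have fin: "finite (descent_set n \<alpha>)" and "\<forall>x\<in>descent_set n \<alpha>. x < n"
    by (simp_all add: descent_set_def)
  then have "sorted_wrt (<) (sorted_list_of_set (descent_set n \<alpha>) @ [n])"
    by (simp add: sorted_wrt_append)
  from partial_sums_differences[OF this] fin show ?thesis
    by (simp add: descent_composition_def Let_def)
qed

definition weight :: "nat set list \<Rightarrow> nat" where
  "weight C = (\<Sum>i<length C. i * \<Sum>(C ! i))"

context positive_composition
begin

text \<open>Positivity makes \<open>psum\<close> strictly increasing, so the sorted list of partial
  sums is the list of values of \<open>psum\<close>, and consecutive differences return the parts of
  \<open>c\<close>.\<close>

lemma descent_composition_eqI:
  assumes "descent_set n \<alpha> = partial_sums c"
  shows "descent_composition n \<alpha> = c"
proof -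
  let ?k = "length c"
  let ?s = "map psum [1..<?k]"
  have "sorted_wrt (<) ?s"
    by (auto simp: sorted_wrt_iff_nth_less intro: psum_strict_mono)
  moreover have "set ?s = partial_sums c"
    by (simp add: partial_sums_psum)
  ultimately have s: "sorted_list_of_set (partial_sums c) = ?s"
    by (metis finite_partial_sums set_sorted_list_of_set strict_sorted_equal
        strict_sorted_list_of_set)
  have k: "0 < ?k"
    using nonempty by simp
  have "map2 (-) (?s @ [n]) (0 # ?s) = c"
  proof (rule nth_equalityI)
    fix i assume "i < length (map2 (-) (?s @ [n]) (0 # ?s))"
    then have i: "i < ?k"
      using k by simp
    have "(?s @ [n]) ! i = psum (Suc i)"
      using i by (cases "Suc i = ?k") (auto simp: nth_append)
    moreover have "(0 # ?s) ! i = psum i"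
      using i by (cases i) auto
    ultimately show "map2 (-) (?s @ [n]) (0 # ?s) ! i = c ! i"
      using i by (simp add: psum_Suc)
  qed (use k in simp)
  then show ?thesis
    by (simp add: descent_composition_def assms s)
qed

text \<open>Later arguments need only ascents and descents at single positions, which the descent
  set records directly.\<close>

lemma perms_with_descents_iff:
  "\<alpha> \<in> perms_with_descents n c \<longleftrightarrow> \<alpha> permutes {1..n} \<and> descent_set n \<alpha> = partial_sums c"
  using descent_composition_eqI partial_sums_descent_composition
  by (auto simp: perms_with_descents_def)

lemma descent_less: "\<alpha> \<in> perms_with_descents n c \<Longrightarrow> p \<in> partial_sums c \<Longrightarrow> \<alpha> (Suc p) < \<alpha> p"
  by (auto simp: perms_with_descents_iff descent_set_def)

lemma ascent_less:
  assumes "\<alpha> \<in> perms_with_descents n c" "p \<in> {1..<n}" "p \<notin> partial_sums c"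
  shows "\<alpha> p < \<alpha> (Suc p)"
proof -
  have "\<not> \<alpha> (Suc p) < \<alpha> p" "inj \<alpha>"
    using assms by (auto simp: perms_with_descents_iff descent_set_def dest: permutes_inj)
  then show ?thesis
    by (metis injD linorder_neqE_nat n_not_Suc_n)
qed

lemma finite_perms_with_descents: "finite (perms_with_descents n c)"
  by (rule finite_subset[OF _ finite_permutations[of "{1..n}"]])
    (auto simp: perms_with_descents_def)

section \<open>Column intervals and the column group\<close>

lemma finite_column_group: "finite (column_group n c)"
  by (rule finite_subset[OF _ finite_permutations[of "{1..n}"]])
    (auto simp: column_group_def)

lemma id_in_column_group: "id \<in> column_group n c"
  by (simp add: column_group_def permutes_id)

lemma column_group_permutes: "\<gamma> \<in> column_group n c \<Longrightarrow> \<gamma> permutes {1..n}"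
  by (simp add: column_group_def)

text \<open>Maximality: a linked interval that ends at \<open>p\<close> could be extended to
  \<open>Suc p\<close>, and one that starts at \<open>Suc p\<close> could be extended to
  \<open>p\<close>, as \<open>p\<close> is a partial sum.\<close>

lemma column_closed:
  assumes K: "K \<in> column_intervals n c" and p: "p \<in> partial_sums c"
  shows "p \<in> K \<longleftrightarrow> Suc p \<in> K"
proof -
  have maxi: "K = L" if "L \<in> linked_intervals n c" "K \<subseteq> L" for L
    using K that by (auto simp: column_intervals_def)
  obtain a b where ab: "K = {a..b}" "1 \<le> a" "a \<le> b" "b \<le> n" "\<forall>j\<in>{a..<b}. j \<in> partial_sums c"
    using K by (auto simp: column_intervals_def linked_intervals_def)
  have pn: "1 \<le> p" "p < n"
    using p partial_sums_subset by auto
  have "b \<noteq> p"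
  proof
    assume b: "b = p"
    then have "{a..Suc b} \<in> linked_intervals n c"
      unfolding linked_intervals_def using ab p pn by (force simp: less_Suc_eq)
    from maxi[OF this] have "{a..b} = {a..Suc b}"
      using ab by auto
    then show False
      using ab(3) by (simp add: Icc_eq_Icc)
  qed
  moreover have "a \<noteq> Suc p"
  proof
    assume a: "a = Suc p"
    then have "{p..b} \<in> linked_intervals n c"
      unfolding linked_intervals_def using ab p pn
      by (intro CollectI exI[of _ p] exI[of _ b]) (auto simp: Suc_le_eq order_le_less)
    from maxi[OF this] have "{a..b} = {p..b}"
      using ab a by auto
    then show False
      using ab(3) a by (simp add: Icc_eq_Icc)
  qed
  ultimately show ?thesis
    unfolding ab(1) by auto
qed

lemma column_linked:
  assumes "K \<in> column_intervals n c" "a \<in> K" "b \<in> K" "a \<le> j" "j < b"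
  shows "j \<in> partial_sums c" "j \<in> K"
  using assms by (auto simp: column_intervals_def linked_intervals_def)

text \<open>The singleton of \<open>q\<close> is linked because its condition is vacuous, and one of
  the finitely many linked intervals above it is maximal.\<close>

lemma ex_column:
  assumes "q \<in> {1..n}"
  shows "\<exists>K\<in>column_intervals n c. q \<in> K"
proof -
  have "linked_intervals n c \<subseteq> Pow {1..n}"
    by (auto simp: linked_intervals_def)
  then have "finite (linked_intervals n c)"
    by (rule finite_subset) simp
  moreover have "{q..q} \<in> linked_intervals n c"
    using assms unfolding linked_intervals_def by (intro CollectI exI[of _ q]) auto
  ultimately obtain K where "K \<in> linked_intervals n c" "{q..q} \<subseteq> K"
    "\<forall>L\<in>linked_intervals n c. K \<subseteq> L \<longrightarrow> K = L"
    by (meson finite_has_maximal2)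
  then show ?thesis
    by (auto simp: column_intervals_def)
qed

text \<open>Each column contains both or neither of the two positions, so the transposition
  preserves it.\<close>

lemma column_group_swap:
  assumes "\<gamma> \<in> column_group n c" and p: "p \<in> partial_sums c"
  shows "\<gamma> \<circ> transpose p (Suc p) \<in> column_group n c"
proof -
  have "transpose p (Suc p) permutes {1..n}"
    using p partial_sums_subset by (intro permutes_swap_id) auto
  moreover have "(\<gamma> \<circ> transpose p (Suc p)) ` K = K" if "K \<in> column_intervals n c" for K
  proof -
    have "transpose p (Suc p) ` K = K" "\<gamma> ` K = K"
      using assms(1) that column_closed[OF that p]
      by (simp_all add: column_group_def transpose_image_eq)
    then show ?thesis
      by (metis image_comp)
  qed
  ultimately show ?thesis
    using assms(1) by (simp add: column_group_def permutes_compose)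
qed

text \<open>Inside a column every position but the last is a partial sum, so comparisons of
  neighbours chain together.\<close>

lemma column_chain:
  fixes f :: "nat \<Rightarrow> 'b::linorder"
  assumes "K \<in> column_intervals n c" "a \<in> K" "b \<in> K" "a < b"
    and "\<And>p. p \<in> partial_sums c \<Longrightarrow> p \<in> K \<Longrightarrow> Suc p \<in> K \<Longrightarrow> f p < f (Suc p)"
  shows "f a < f b"
  using \<open>a < b\<close> \<open>b \<in> K\<close>
proof (induction b)
  case (Suc b)
  have b: "b \<in> partial_sums c" "b \<in> K"
    using column_linked[of K a "Suc b" b] assms Suc.prems by auto
  then have "f b < f (Suc b)"
    using assms Suc.prems by blast
  then show ?case
    using Suc b by (cases "a = b") auto
qed simp

lemma column_decreasing:
  assumes "\<alpha> \<in> perms_with_descents n c" "K \<in> column_intervals n c" "a \<in> K" "b \<in> K" "a < b"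
  shows "\<alpha> b < \<alpha> a"
  \<comment> \<open>Negated values, taken as integers, turn the decrease into the increase that
    \<open>column_chain\<close> treats.\<close>
  using column_chain[of K a b "\<lambda>p. - int (\<alpha> p)"] assms descent_less by simp

text \<open>At the least moved position \<open>q\<close>, its preimage \<open>m\<close> in the
  column lies to the right and \<open>\<gamma> q\<close> exceeds \<open>q = \<gamma> m\<close>,
  against the increase along the column.\<close>

lemma column_group_increasing_id:
  assumes \<gamma>: "\<gamma> \<in> column_group n c"
    and inc: "\<And>p. p \<in> partial_sums c \<Longrightarrow> \<gamma> p < \<gamma> (Suc p)"
  shows "\<gamma> = id"
proof
  fix q
  have inj: "inj \<gamma>"
    using column_group_permutes[OF \<gamma>] by (rule permutes_inj)
  show "\<gamma> q = id q"
  proof (induction q rule: less_induct)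
    case (less q)
    show ?case
    proof (rule ccontr)
      assume neq: "\<gamma> q \<noteq> id q"
      then have "q \<in> {1..n}"
        using permutes_not_in[OF column_group_permutes[OF \<gamma>]] by auto
      then obtain K where K: "K \<in> column_intervals n c" "q \<in> K"
        using ex_column by blast
      then have "q \<in> \<gamma> ` K"
        using \<gamma> by (simp add: column_group_def)
      then obtain m where m: "m \<in> K" "\<gamma> m = q"
        by blast
      have "q < m"
        using less m neq by (metis id_apply linorder_neqE_nat)
      moreover have "q < \<gamma> q"
        using less neq inj by (metis id_apply injD linorder_neqE_nat)
      ultimately show False
        using column_chain[of K q m \<gamma>] K m inc by auto
    qed
  qed
qed

section \<open>Weights of faces and their change under swaps\<close>

lemma weight_osp_of_perm:
  assumes "\<alpha> permutes {1..n}"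
  shows "weight (osp_of_perm \<alpha> c) = (\<Sum>p\<in>{1..n}. row p * \<alpha> p)"
proof -
  have inj: "inj_on \<alpha> A" for A
    using permutes_inj[OF assms] by (rule inj_on_subset) simp
  have "weight (osp_of_perm \<alpha> c) = (\<Sum>i<length c. i * (\<Sum>p\<in>position_block c i. \<alpha> p))"
    by (simp add: weight_def sum.reindex[OF inj])
  also have "\<dots> = (\<Sum>i<length c. \<Sum>p\<in>{p \<in> {1..n}. row p = i}. row p * \<alpha> p)"
    by (intro sum.cong) (auto simp: position_block_eq sum_distrib_left)
  also have "\<dots> = (\<Sum>p\<in>{1..n}. row p * \<alpha> p)"
    by (rule sum.group) (use position_block_row in auto)
  finally show ?thesis .
qed

text \<open>The row indices of \<open>p\<close> and \<open>Suc p\<close> differ by one, so the swap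
  lowers the weight by exactly \<open>\<alpha> (Suc p) - \<alpha> p\<close>.\<close>

lemma weight_swap_less:
  assumes \<alpha>: "\<alpha> permutes {1..n}" and p: "p \<in> partial_sums c" and less: "\<alpha> p < \<alpha> (Suc p)"
  shows "weight (osp_of_perm (\<alpha> \<circ> transpose p (Suc p)) c) < weight (osp_of_perm \<alpha> c)"
proof -
  let ?\<tau> = "transpose p (Suc p)"
  have in_n: "p \<in> {1..n}" "Suc p \<in> {1..n} - {p}"
    using p partial_sums_subset by auto
  have \<tau>: "?\<tau> permutes {1..n}"
    using in_n by (intro permutes_swap_id) auto
  have split: "(\<Sum>q\<in>{1..n}. f q) = f p + (f (Suc p) + (\<Sum>q\<in>{1..n} - {p} - {Suc p}. f q))"
    for f :: "nat \<Rightarrow> nat"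
    using in_n by (metis finite_Diff finite_atLeastAtMost sum.remove)
  have "(\<Sum>q\<in>{1..n} - {p} - {Suc p}. row q * (\<alpha> \<circ> ?\<tau>) q)
      = (\<Sum>q\<in>{1..n} - {p} - {Suc p}. row q * \<alpha> q)"
    by (intro sum.cong) auto
  moreover have "row p * \<alpha> (Suc p) + row (Suc p) * \<alpha> p < row p * \<alpha> p + row (Suc p) * \<alpha> (Suc p)"
    using less by (simp add: row_Suc[OF p])
  ultimately show ?thesis
    unfolding weight_osp_of_perm[OF permutes_compose[OF \<tau> \<alpha>]] weight_osp_of_perm[OF \<alpha>] split
    by simp
qed

text \<open>Induction on the weight of the right-hand face: a swap at a suitable row end lowers it
  and leaves either the identity or a smaller instance.\<close>

lemma weight_perm_less:
  assumes \<alpha>: "\<alpha> \<in> perms_with_descents n c"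
    and "\<gamma> \<in> column_group n c" "\<gamma> \<noteq> id"
  shows "weight (osp_of_perm \<alpha> c) < weight (osp_of_perm (\<alpha> \<circ> \<gamma>) c)"
  using assms(2,3)
proof (induction "weight (osp_of_perm (\<alpha> \<circ> \<gamma>) c)" arbitrary: \<gamma> rule: less_induct)
  case less
  have \<gamma>: "\<gamma> permutes {1..n}"
    using less.prems(1) by (rule column_group_permutes)
  obtain p where p: "p \<in> partial_sums c" "\<not> \<gamma> p < \<gamma> (Suc p)"
    using column_group_increasing_id less.prems by blast
  then have gt: "\<gamma> (Suc p) < \<gamma> p"
    using permutes_inj[OF \<gamma>] by (metis injD linorder_neqE_nat n_not_Suc_n)
  have "p \<in> {1..n}"
    using p partial_sums_subset by auto
  then obtain K where K: "K \<in> column_intervals n c" "p \<in> K"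
    using ex_column by blast
  then have "Suc p \<in> K" "\<gamma> ` K = K"
    using column_closed p less.prems by (auto simp: column_group_def)
  \<comment> \<open>\<open>\<alpha>\<close> decreases along the column, so the descent of
    \<open>\<gamma>\<close> at \<open>p\<close> becomes an ascent of
    \<open>\<alpha> \<circ> \<gamma>\<close>.\<close>
  then have "\<alpha> (\<gamma> p) < \<alpha> (\<gamma> (Suc p))"
    using column_decreasing[OF \<alpha> K(1) _ _ gt] K by blast
  moreover have "\<alpha> permutes {1..n}"
    using \<alpha> by (simp add: perms_with_descents_iff)
  ultimately have lt: "weight (osp_of_perm (\<alpha> \<circ> (\<gamma> \<circ> transpose p (Suc p))) c)
      < weight (osp_of_perm (\<alpha> \<circ> \<gamma>) c)"
    using weight_swap_less[of "\<alpha> \<circ> \<gamma>" p] p \<gamma> by (simp add: permutes_compose o_assoc)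
  show ?case
  proof (cases "\<gamma> \<circ> transpose p (Suc p) = id")
    case True
    then show ?thesis
      using lt by simp
  next
    case False
    then show ?thesis
      using less.hyps[OF lt column_group_swap] less.prems p lt by simp
  qed
qed

section \<open>Faces that come from permutations with the given descents\<close>

lemma strict_mono_on_position_block:
  fixes \<alpha> :: "nat \<Rightarrow> nat"
  assumes asc: "\<And>p. p \<in> {1..<n} \<Longrightarrow> p \<notin> partial_sums c \<Longrightarrow> \<alpha> p < \<alpha> (Suc p)"
    and i: "i < length c"
  shows "strict_mono_on (position_block c i) \<alpha>"
proof (rule strict_mono_onI)
  fix a b assume a: "a \<in> position_block c i" and "b \<in> position_block c i" "a < b"
  then show "\<alpha> a < \<alpha> b"
  proof (induction b)
    case (Suc b)
    then have b: "b \<in> position_block c i"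
      by (auto simp: position_block_psum)
    then have "row b = row (Suc b)"
      using Suc.prems i by (simp add: row_position_block)
    then have "b \<notin> partial_sums c"
      by (metis n_not_Suc_n row_Suc)
    moreover have "b \<in> {1..<n}"
      using b Suc.prems position_block_subset[OF i] by fastforce
    ultimately have "\<alpha> b < \<alpha> (Suc b)"
      by (intro asc)
    then show ?case
      using Suc b by (cases "a = b") auto
  qed simp
qed

text \<open>The values in each row appear in increasing order, so the set of values of a row
  determines the permutation on it.\<close>

lemma inj_on_osp_of_perm: "inj_on (\<lambda>\<alpha>. osp_of_perm \<alpha> c) (perms_with_descents n c)"
proof (rule inj_onI)
  fix \<alpha> \<beta>
  assume \<alpha>: "\<alpha> \<in> perms_with_descents n c" and \<beta>: "\<beta> \<in> perms_with_descents n c"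
    and eq: "osp_of_perm \<alpha> c = osp_of_perm \<beta> c"
  show "\<alpha> = \<beta>"
  proof
    fix p
    show "\<alpha> p = \<beta> p"
    proof (cases "p \<in> {1..n}")
      case True
      define i where "i = row p"
      have i: "i < length c" and p: "p \<in> position_block c i"
        using position_block_row[OF True] by (simp_all add: i_def)
      \<comment> \<open>The block excludes \<open>psum i\<close> and includes
        \<open>psum (Suc i)\<close>; list intervals do the opposite at their ends, hence the two
        shifts by one.\<close>
      let ?l = "[Suc (psum i)..<Suc (psum (Suc i))]"
      have l: "set ?l = position_block c i"
        by (auto simp: position_block_psum)
      have sorted: "sorted_wrt (<) (map f ?l)" if "f \<in> perms_with_descents n c" for f
      proof -
        have "strict_mono_on (set ?l) f"
          unfolding l using that i by (intro strict_mono_on_position_block ascent_less)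
        then show ?thesis
          unfolding sorted_wrt_map
          by (intro sorted_wrt_mono_rel[OF _ sorted_wrt_upt]) (rule strict_mono_onD)
      qed
      have "\<alpha> ` position_block c i = \<beta> ` position_block c i"
        using eq i by (metis nth_osp_of_perm)
      then have "map \<alpha> ?l = map \<beta> ?l"
        by (intro strict_sorted_equal sorted \<alpha> \<beta>) (simp only: set_map l)
      then show ?thesis
        using p l by (metis map_eq_conv)
    next
      case False
      then show ?thesis
        using \<alpha> \<beta> by (auto simp: perms_with_descents_iff permutes_def)
    qed
  qed
qed

text \<open>List each block in increasing order: the hypothesis puts the largest entry of a block
  above the least entry of the next, so the descents fall exactly at the row ends. The
  contrapositive finds two adjacent blocks in order in every other face.\<close>

lemma facet_eq_osp_of_perm:
  assumes C: "C \<in> facets"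
    and desc: "\<And>i. Suc i < length c \<Longrightarrow> \<exists>x\<in>C ! i. \<exists>y\<in>C ! Suc i. y < x"
  shows "\<exists>\<alpha>\<in>perms_with_descents n c. osp_of_perm \<alpha> c = C"
proof -
  \<comment> \<open>Subtracting \<open>Suc (psum (row p))\<close> gives the index, from
    \<open>0\<close>, of \<open>p\<close> within its row; outside \<open>{1..n}\<close> the value
    \<open>p\<close> is what \<open>permutes\<close> demands.\<close>
  define \<alpha> where "\<alpha> p =
    (if p \<in> {1..n} then sorted_list_of_set (C ! row p) ! (p - Suc (psum (row p))) else p)" for p
  have \<alpha>_block: "\<alpha> p = sorted_list_of_set (C ! i) ! (p - Suc (psum i))"
    if "i < length c" "p \<in> position_block c i" for i p
    using that position_block_subset[OF that(1)] row_position_block[OF that]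
    by (auto simp: \<alpha>_def)
  have len: "length (sorted_list_of_set (C ! i)) = c ! i" if "i < length c" for i
    using that C by (simp add: facet_card)
  have image: "\<alpha> ` position_block c i = C ! i" if i: "i < length c" for i
  proof -
    have "\<alpha> ` position_block c i
        = (\<lambda>p. sorted_list_of_set (C ! i) ! (p - Suc (psum i))) ` position_block c i"
      using \<alpha>_block[OF i] by (intro image_cong) auto
    also have "\<dots> = (\<lambda>p. sorted_list_of_set (C ! i) ! (p - Suc (psum i))) `
        (\<lambda>m. m + Suc (psum i)) ` {0..<c ! i}"
      unfolding image_add_atLeastLessThan' position_block_psum psum_Suc[OF i]
      by (rule arg_cong[of _ _ "\<lambda>A. _ ` A"]) auto
    also have "\<dots> = set (sorted_list_of_set (C ! i))"
      using len[OF i] by (auto simp: image_image in_set_conv_nth)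
    also have "\<dots> = C ! i"
      using C i by (simp add: facet_finite)
    finally show ?thesis .
  qed
  have "\<alpha> ` {1..n} = {1..n}"
  proof -
    have "{1..n} = (\<Union>i<length c. position_block c i)"
      using position_block_subset ex_position_block by blast
    then have "\<alpha> ` {1..n} = (\<Union>i<length c. \<alpha> ` position_block c i)"
      by (simp only: image_UN)
    also have "\<dots> = (\<Union>i<length c. C ! i)"
      by (simp add: image)
    also have "\<dots> = \<Union>(set C)"
      using facet_length[OF C] by (auto simp: set_conv_nth)
    finally show ?thesis
      using facet_Union[OF C] by simp
  qed
  then have perm: "\<alpha> permutes {1..n}"
    by (intro bij_imp_permutes) (auto simp: bij_betw_def \<alpha>_def intro: finite_surj_inj)
  have ascent: "\<alpha> p < \<alpha> (Suc p)" if p: "p \<in> {1..<n}" "p \<notin> partial_sums c" for p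
  proof -
    define i where "i = row p"
    have i: "i < length c" "p \<in> position_block c i" "Suc p \<in> position_block c i"
      using p position_block_row[of p] position_block_row[of "Suc p"] row_Suc_eq[of p]
      by (auto simp: i_def)
    moreover have "sorted_wrt (<) (sorted_list_of_set (C ! i))"
      by simp
    ultimately show ?thesis
      using len by (simp add: \<alpha>_block sorted_wrt_iff_nth_less position_block_psum psum_Suc)
  qed
  have descent: "\<alpha> (Suc p) < \<alpha> p" if p: "p \<in> partial_sums c" for p
  proof -
    obtain i where i: "Suc i < length c" "p = psum (Suc i)"
      using p by (fastforce simp: partial_sums_psum Suc_le_eq dest: gr0_implies_Suc)
    obtain x y where xy: "x \<in> C ! i" "y \<in> C ! Suc i" "y < x"
      using desc[OF i(1)] by blast
    obtain q where q: "q \<in> position_block c i" "x = \<alpha> q"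
      using xy image[of i] i by auto
    obtain r where r: "r \<in> position_block c (Suc i)" "y = \<alpha> r"
      using xy image[of "Suc i"] i by auto
    have mono: "strict_mono_on (position_block c j) \<alpha>" if "j < length c" for j
      using ascent that by (rule strict_mono_on_position_block)
    \<comment> \<open>\<open>p\<close> is the last position of its row and \<open>Suc p\<close> the
      first of the next, so \<open>\<alpha> (Suc p) \<le> y < x \<le> \<alpha> p\<close>.\<close>
    have "p \<in> position_block c i" "q \<le> p"
      using q i psum_strict_mono[of i "Suc i"] by (auto simp: position_block_psum)
    then have "x \<le> \<alpha> p"
      using q mono[of i] i by (simp add: strict_mono_on_leD)
    moreover have "Suc p \<in> position_block c (Suc i)" "Suc p \<le> r"
      using r i psum_strict_mono[of "Suc i" "Suc (Suc i)"] by (auto simp: position_block_psum)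
    then have "\<alpha> (Suc p) \<le> y"
      using r mono[of "Suc i"] i by (simp add: strict_mono_on_leD)
    ultimately show ?thesis
      using xy by simp
  qed
  have "descent_set n \<alpha> = partial_sums c"
    using ascent descent partial_sums_subset by (force simp: descent_set_def dest: order_less_asym)
  moreover have "osp_of_perm \<alpha> c = C"
    using facet_length[OF C] image by (intro nth_equalityI) auto
  ultimately show ?thesis
    using perm by (auto simp: perms_with_descents_iff)
qed

end

section \<open>Bases of homology from unitriangular systems\<close>

text \<open>Elements enter in order of weight. A genuinely new \<open>x\<close> has zero entries at
  all earlier \<open>y\<close>, so its coefficient can repair the equation at \<open>x\<close>
  without disturbing the others.\<close>

lemma unitriangular_solve:
  fixes A :: "'a \<Rightarrow> 'a \<Rightarrow> 'f::comm_ring_1" and w :: "'a \<Rightarrow> nat"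
  assumes "finite D"
    and diag: "\<And>x. x \<in> D \<Longrightarrow> A x x = 1"
    and tri: "\<And>x y. x \<in> D \<Longrightarrow> y \<in> D \<Longrightarrow> A x y \<noteq> 0 \<Longrightarrow> x = y \<or> w x < w y"
  shows "\<exists>a. \<forall>y\<in>D. (\<Sum>x\<in>D. a x * A x y) = v y"
  using assms
proof (induction D rule: finite_ranking_induct[where f = w])
  case (insert x S)
  show ?case
  proof (cases "x \<in> S")
    case True
    then show ?thesis
      using insert by (simp add: insert_absorb)
  next
    case False
    obtain a where a: "\<forall>y\<in>S. (\<Sum>x\<in>S. a x * A x y) = v y"
      using insert by auto
    \<comment> \<open>The diagonal entry is \<open>1\<close>, so the coefficient at \<open>x\<close>
      is just the error left there by \<open>S\<close>, with no division.\<close>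
    define b where "b = a(x := v x - (\<Sum>x'\<in>S. a x' * A x' x))"
    have "(\<Sum>x'\<in>insert x S. b x' * A x' y) = b x * A x y + (\<Sum>x'\<in>S. a x' * A x' y)" for y
      using False \<open>finite S\<close> by (auto simp: b_def intro!: sum.cong)
    moreover have "A x y = 0" if "y \<in> S" for y
      using insert.prems(2)[of x y] insert.hyps(2)[OF that] that False by fastforce
    ultimately have "\<forall>y\<in>insert x S. (\<Sum>x'\<in>insert x S. b x' * A x' y) = v y"
      using a insert.prems(1)[of x] by (simp add: b_def)
    then show ?thesis
      by blast
  qed
qed simp

text \<open>In the same order, the newest element contributes nothing to the earlier equations; the
  earlier coefficients vanish by induction, and the diagonal then kills the newest.\<close>

lemma unitriangular_kernel:
  fixes A :: "'a \<Rightarrow> 'a \<Rightarrow> 'f::comm_ring_1" and w :: "'a \<Rightarrow> nat"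
  assumes "finite D"
    and "\<And>x. x \<in> D \<Longrightarrow> A x x = 1"
    and "\<And>x y. x \<in> D \<Longrightarrow> y \<in> D \<Longrightarrow> A x y \<noteq> 0 \<Longrightarrow> x = y \<or> w x < w y"
    and "\<And>y. y \<in> D \<Longrightarrow> (\<Sum>x\<in>D. a x * A x y) = 0"
  shows "\<forall>x\<in>D. a x = 0"
  using assms
proof (induction D rule: finite_ranking_induct[where f = w])
  case (insert x S)
  show ?case
  proof (cases "x \<in> S")
    case True
    show ?thesis
      unfolding insert_absorb[OF True]
      by (rule insert.IH) (fact insert.prems[unfolded insert_absorb[OF True]])+
  next
    case False
    have "A x y = 0" if "y \<in> S" for y
      using insert.prems(2)[of x y] insert.hyps(2)[OF that] that False by fastforce
    then have zero: "(\<Sum>x'\<in>S. a x' * A x' y) = 0" if "y \<in> S" for y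
      using insert.prems(3)[of y] that False \<open>finite S\<close> by simp
    have S: "\<forall>x\<in>S. a x = 0"
      by (rule insert.IH) (use insert.prems(1,2) zero in blast)+
    then have "a x = 0"
      using insert.prems(1,3)[of x] False \<open>finite S\<close> by simp
    then show ?thesis
      using S by simp
  qed
qed simp

section \<open>Linear combinations and bases of classes, read on representatives\<close>

lemma homology_finsum:
  fixes g :: "'a \<Rightarrow> 'f::field chain"
  assumes "finite S" "\<And>\<alpha>. \<alpha> \<in> S \<Longrightarrow> g \<alpha> \<in> cycles X j"
  shows "(\<Oplus>\<^bsub>homology X j\<^esub>\<alpha>\<in>S. b \<alpha> \<odot>\<^bsub>homology X j\<^esub> homology_class X j (g \<alpha>)) =
    homology_class X j (\<Sum>\<alpha>\<in>S. chain_scale (b \<alpha>) (g \<alpha>))"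
proof -
  interpret vectorspace "class_ring :: 'f ring" "homology X j :: ('f, 'f chain set) module"
    by (rule vectorspace_homology)
  define h where "h \<alpha> = homology_class X j (chain_scale (b \<alpha>) (g \<alpha>))" for \<alpha>
  have "finsum (homology X j) h S = homology_class X j (\<Sum>\<alpha>\<in>S. chain_scale (b \<alpha>) (g \<alpha>))"
    using assms
  proof (induction S)
    case empty
    show ?case
      by (simp only: M.finsum_empty homology_zero sum.empty)
  next
    case (insert \<alpha> S)
    have closed: "h \<beta> \<in> carrier (homology X j)" if "\<beta> \<in> insert \<alpha> S" for \<beta>
      unfolding h_def homology_carrier using insert.prems[OF that] cycles_closed(3) by blast
    have "finsum (homology X j) h (insert \<alpha> S) = h \<alpha> \<oplus>\<^bsub>homology X j\<^esub> finsum (homology X j) h S"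
      by (intro M.finsum_insert[OF insert.hyps] Pi_I closed) simp_all
    moreover have "finsum (homology X j) h S = homology_class X j (\<Sum>\<alpha>\<in>S. chain_scale (b \<alpha>) (g \<alpha>))"
      by (rule insert.IH) (simp add: insert.prems)
    ultimately show ?case
      by (simp only: h_def[of \<alpha>] homology_add sum.insert[OF insert.hyps])
  qed
  then show ?thesis
    unfolding h_def homology_smult .
qed

text \<open>\<open>vectorspace.basis\<close> speaks of a set of vectors, whereas the cycles form an
  indexed family; hence injectivity of the indexing is a conclusion of its own. The hypotheses use
  representatives in place of sums of cosets.\<close>

lemma homology_basisI:
  fixes g :: "'a \<Rightarrow> 'f::field chain"
  assumes fin_D: "finite D" and cyc: "\<And>\<alpha>. \<alpha> \<in> D \<Longrightarrow> g \<alpha> \<in> cycles X j"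
    and indep: "\<And>b. homology_class X j (\<Sum>\<alpha>\<in>D. chain_scale (b \<alpha>) (g \<alpha>)) = homology_class X j 0 \<Longrightarrow>
      \<forall>\<alpha>\<in>D. b \<alpha> = 0"
    and span: "\<And>z. z \<in> cycles X j \<Longrightarrow>
      \<exists>b. homology_class X j z = homology_class X j (\<Sum>\<alpha>\<in>D. chain_scale (b \<alpha>) (g \<alpha>))"
  shows "inj_on (\<lambda>\<alpha>. homology_class X j (g \<alpha>)) D"
    and "vectorspace.basis (class_ring :: 'f ring) (homology X j)
      ((\<lambda>\<alpha>. homology_class X j (g \<alpha>)) ` D)"
proof -
  interpret vectorspace "class_ring :: 'f ring" "homology X j :: ('f, 'f chain set) module"
    by (rule vectorspace_homology)
  let ?H = "homology X j :: ('f, 'f chain set) module"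
  let ?h = "\<lambda>\<alpha>. homology_class X j (g \<alpha>)"
  show inj: "inj_on ?h D"
  proof (rule inj_onI, rule ccontr)
    fix \<alpha> \<beta> assume D: "\<alpha> \<in> D" "\<beta> \<in> D" and eq: "?h \<alpha> = ?h \<beta>" and neq: "\<alpha> \<noteq> \<beta>"
    \<comment> \<open>If two classes agreed, the coefficients \<open>1\<close> and
      \<open>- 1\<close> would give a relation that \<open>indep\<close> forbids, in every
      characteristic.\<close>
    define b where "b = (\<lambda>\<gamma>. if \<gamma> = \<alpha> then 1 else if \<gamma> = \<beta> then - 1 else 0 :: 'f)"
    have "(\<Sum>\<gamma>\<in>D. chain_scale (b \<gamma>) (g \<gamma>)) = (\<Sum>\<gamma>\<in>{\<alpha>, \<beta>}. chain_scale (b \<gamma>) (g \<gamma>))"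
      by (rule sum.mono_neutral_right) (use fin_D D in \<open>auto simp: b_def chain_scale_simps\<close>)
    also have "\<dots> = g \<alpha> + chain_scale (- 1) (g \<beta>)"
      using neq by (simp add: b_def chain_scale_simps)
    also have "homology_class X j \<dots> = homology_class X j (g \<beta> + chain_scale (- 1) (g \<beta>))"
      by (simp add: eq flip: homology_add)
    also have "g \<beta> + chain_scale (- 1) (g \<beta>) = chain_scale (1 + - 1) (g \<beta>)"
      by (simp only: chain_scale_simps)
    finally have "\<forall>\<gamma>\<in>D. b \<gamma> = 0"
      by (intro indep) (simp add: chain_scale_simps)
    then show False
      using D by (auto simp: b_def)
  qed
  have lincomb: "lincomb a (?h ` S) = homology_class X j (\<Sum>\<alpha>\<in>S. chain_scale (a (?h \<alpha>)) (g \<alpha>))"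
    if "S \<subseteq> D" for a S
  proof -
    have S: "finite S" "inj_on ?h S" "\<And>\<alpha>. \<alpha> \<in> S \<Longrightarrow> g \<alpha> \<in> cycles X j"
      using that fin_D inj cyc by (auto intro: finite_subset inj_on_subset)
    have "lincomb a (?h ` S) = (\<Oplus>\<^bsub>?H\<^esub>\<alpha>\<in>S. a (?h \<alpha>) \<odot>\<^bsub>?H\<^esub> ?h \<alpha>)"
      unfolding lincomb_def
      by (rule M.finsum_reindex) (use S in \<open>auto simp: homology_smult homology_carrier cycles_closed\<close>)
    then show ?thesis
      using homology_finsum[OF S(1,3)] by simp
  qed
  \<comment> \<open>A dependence may involve only some of the vectors, with coefficients attached to
    vectors; extension by zero turns it into a relation indexed by all of \<open>D\<close>.\<close>
  have lincomb_subset: "\<exists>b. lincomb a A = homology_class X j (\<Sum>\<alpha>\<in>D. chain_scale (b \<alpha>) (g \<alpha>)) \<and>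
      (\<forall>\<alpha>\<in>D. ?h \<alpha> \<in> A \<longrightarrow> b \<alpha> = a (?h \<alpha>))" if "A \<subseteq> ?h ` D" for a A
  proof -
    define S where "S = {\<alpha> \<in> D. ?h \<alpha> \<in> A}"
    define b where "b = (\<lambda>\<alpha>. if ?h \<alpha> \<in> A then a (?h \<alpha>) else 0)"
    have "A = ?h ` S"
      using that by (auto simp: S_def)
    then have "lincomb a A = lincomb a (?h ` S)"
      by (rule arg_cong)
    also have "\<dots> = homology_class X j (\<Sum>\<alpha>\<in>S. chain_scale (a (?h \<alpha>)) (g \<alpha>))"
      by (rule lincomb) (simp add: S_def)
    also have "(\<Sum>\<alpha>\<in>S. chain_scale (a (?h \<alpha>)) (g \<alpha>)) = (\<Sum>\<alpha>\<in>D. chain_scale (b \<alpha>) (g \<alpha>))"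
      by (rule sum.mono_neutral_cong_left)
        (use fin_D in \<open>auto simp: S_def b_def chain_scale_simps\<close>)
    finally show ?thesis
      by (intro exI[of _ b] conjI) (simp_all add: b_def)
  qed
  have "\<not> lin_dep (?h ` D)"
  proof
    assume "lin_dep (?h ` D)"
    then obtain A a v where A: "A \<subseteq> ?h ` D" "lincomb a A = \<zero>\<^bsub>?H\<^esub>" "v \<in> A" "a v \<noteq> 0"
      unfolding lin_dep_def by auto
    from lincomb_subset[OF A(1), of a] obtain b
      where "lincomb a A = homology_class X j (\<Sum>\<alpha>\<in>D. chain_scale (b \<alpha>) (g \<alpha>))"
        and b: "\<forall>\<alpha>\<in>D. ?h \<alpha> \<in> A \<longrightarrow> b \<alpha> = a (?h \<alpha>)"
      by blast
    then have "\<forall>\<alpha>\<in>D. b \<alpha> = 0"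
      using A(2) by (intro indep) (simp add: homology_zero)
    then show False
      using A b by auto
  qed
  moreover have "LinearCombinations.module.span class_ring ?H (?h ` D) = carrier ?H"
  proof
    show "LinearCombinations.module.span class_ring ?H (?h ` D) \<subseteq> carrier ?H"
      by (rule span_is_subset2) (auto simp: homology_carrier cyc)
    show "carrier ?H \<subseteq> LinearCombinations.module.span class_ring ?H (?h ` D)"
    proof
      fix Y assume "Y \<in> carrier ?H"
      then obtain z where z: "z \<in> cycles X j" "Y = homology_class X j z"
        by (auto simp: homology_carrier)
      from span[OF z(1)] obtain b
        where "Y = homology_class X j (\<Sum>\<alpha>\<in>D. chain_scale (b \<alpha>) (g \<alpha>))"
        unfolding z(2) by blast
      \<comment> \<open>Injectivity allows the coefficients to be carried from indices to
        vectors.\<close>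
      also have "\<dots> = homology_class X j
          (\<Sum>\<alpha>\<in>D. chain_scale ((b \<circ> the_inv_into D ?h) (?h \<alpha>)) (g \<alpha>))"
        by (rule arg_cong[of _ _ "homology_class X j"], rule sum.cong)
          (simp_all add: the_inv_into_f_f[OF inj])
      also have "\<dots> = lincomb (b \<circ> the_inv_into D ?h) (?h ` D)"
        by (simp add: lincomb)
      finally show "Y \<in> LinearCombinations.module.span class_ring ?H (?h ` D)"
        unfolding span_def using fin_D
        by (intro CollectI exI[of _ "b \<circ> the_inv_into D ?h"] exI[of _ "?h ` D"] conjI) simp_all
    qed
  qed
  moreover have "?h ` D \<subseteq> carrier ?H"
    by (auto simp: homology_carrier cyc)
  ultimately show "basis (?h ` D)"
    unfolding basis_def by blast
qed

section \<open>Cycles in top degree\<close>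

lemma merge_blocks_eqD:
  assumes eq: "merge_blocks i C = merge_blocks i C'" and len: "length C = length C'" "Suc i < length C'"
  shows "C ! i \<union> C ! Suc i = C' ! i \<union> C' ! Suc i"
    and "\<And>l. l < length C' \<Longrightarrow> l \<noteq> i \<Longrightarrow> l \<noteq> Suc i \<Longrightarrow> C ! l = C' ! l"
proof -
  have parts: "take i C = take i C'" "C ! i \<union> C ! Suc i = C' ! i \<union> C' ! Suc i"
    "drop (i + 2) C = drop (i + 2) C'"
    using eq len unfolding merge_blocks_def by (auto simp: append_eq_append_conv)
  show "C ! i \<union> C ! Suc i = C' ! i \<union> C' ! Suc i"
    by (fact parts)
  show "C ! l = C' ! l" if l: "l < length C'" "l \<noteq> i" "l \<noteq> Suc i" for l
  proof (cases "l < i")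
    case True
    then show ?thesis
      using parts(1) by (metis nth_take)
  next
    case False
    then have "i + 2 \<le> l"
      using l by simp
    then have "C ! l = drop (i + 2) C ! (l - (i + 2))" "C' ! l = drop (i + 2) C' ! (l - (i + 2))"
      using l len by (simp_all only: nth_drop le_add_diff_inverse less_imp_le)
    then show ?thesis
      using parts(3) by simp
  qed
qed

text \<open>\<open>B\<close> consists of the largest elements of \<open>A \<union> B\<close>.
  Another subset of that size trades elements of \<open>B\<close> for elements of \<open>A\<close>,
  and a bijection between the two differences raises each element.\<close>

lemma sum_less_of_block_less:
  fixes A B B' :: "nat set"
  assumes fin: "finite A" "finite B" and less: "\<And>x y. x \<in> A \<Longrightarrow> y \<in> B \<Longrightarrow> x < y"
    and B': "B' \<subseteq> A \<union> B" "card B' = card B" "B' \<noteq> B"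
  shows "\<Sum>B' < \<Sum>B"
proof -
  have fin': "finite B'"
    using fin B' by (auto intro: finite_subset)
  have split: "\<Sum>B' = \<Sum>(B' \<inter> B) + \<Sum>(B' - B)" "\<Sum>B = \<Sum>(B' \<inter> B) + \<Sum>(B - B')"
    using fin fin' sum.Int_Diff[of B' "\<lambda>x. x" B] sum.Int_Diff[of B "\<lambda>x. x" B']
    by (simp_all add: Int_commute)
  have "card (B' - B) = card (B - B')"
    using B'(2) card_Int_Diff[OF fin', of B] card_Int_Diff[OF fin(2), of B', unfolded Int_commute[of B B']]
    by linarith
  then obtain f where f: "bij_betw f (B' - B) (B - B')"
    using finite_same_card_bij[of "B' - B" "B - B'"] fin fin' by auto
  have "B' - B \<noteq> {}"
    using B' fin by (metis Diff_eq_empty_iff card_subset_eq)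
  moreover have "x < f x" if "x \<in> B' - B" for x
    using that B'(1) f less by (blast dest: bij_betwE)
  ultimately have "\<Sum>(B' - B) < (\<Sum>x\<in>B' - B. f x)"
    using fin' by (intro sum_strict_mono) auto
  also have "\<dots> = \<Sum>(B - B')"
    using f by (rule sum.reindex_bij_betw)
  finally show ?thesis
    using split by simp
qed

text \<open>Nonempty runs cannot outnumber the entries they cover, and equal numbers force every run
  to be a singleton, which is its own sum.\<close>

lemma pcomp_le_runs:
  assumes "[] \<notin> set runs"
  shows "length runs \<le> length (concat runs) \<and>
    (length runs = length (concat runs) \<longrightarrow> map sum_list runs = concat runs)"
  using assms
proof (induction runs)
  case (Cons r runs)
  then have "0 < length r"
    by auto
  show ?case
  proof (cases "length r = 1")
    case True
    then show ?thesis
      using Cons by (auto simp: length_Suc_conv)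
  next
    case False
    with \<open>0 < length r\<close> have "1 < length r"
      by linarith
    then show ?thesis
      using Cons by auto
  qed
qed simp

lemma pcomp_le_length: "pcomp_le c d \<Longrightarrow> length d \<le> length c"
  using pcomp_le_runs by (fastforce simp: pcomp_le_def)

lemma pcomp_le_same_length: "pcomp_le c d \<Longrightarrow> length d = length c \<Longrightarrow> d = c"
  using pcomp_le_runs by (fastforce simp: pcomp_le_def)

lemma pcomp_le_refl: "pcomp_le c c"
  unfolding pcomp_le_def
  by (rule exI[of _ "map (\<lambda>x. [x]) c"]) (auto simp: comp_def concat_map_singleton)

lemma lookup_face_boundary:
  "Poly_Mapping.lookup (face_boundary C :: 'f::field chain) D =
    (\<Sum>i<length C - 1. if merge_blocks i C = D then (- 1) ^ i else 0)"
  unfolding face_boundary_def lookup_sum by (simp add: lookup_single when_def)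

lemma boundary_sum: "boundary (\<Sum>i\<in>I. f i) = (\<Sum>i\<in>I. boundary (f i))"
  by (induction I rule: infinite_finite_induct) (simp_all add: boundary_zero boundary_add)

lemma boundary_single: "boundary (Poly_Mapping.single C a) = chain_scale a (face_boundary C)"
  by (subst boundary_superset[of "{C}"]) simp_all

context positive_composition
begin

section \<open>Chains, classes and the cycle condition in top degree\<close>

lemma chains_top: "chains (Delta_comp n c) (int (length c) - 2) = {x. Poly_Mapping.keys x \<subseteq> facets}"
proof -
  have "{C \<in> Delta_comp n c. face_dim C = int (length c) - 2} = facets"
    using pcomp_le_same_length pcomp_le_refl
    by (fastforce simp: Delta_comp_def Delta_def facets_def face_dim_def osp_type_def)
  then show ?thesis
    by (simp add: chains_def)
qed

text \<open>A face in this degree would have more blocks than \<open>c\<close> has parts; hence only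
  zero is divided out one degree below.\<close>

lemma chains_above_top: "chains (Delta_comp n c) (int (length c) - 2 + 1) = {0}"
proof -
  have "{C \<in> Delta_comp n c. face_dim C = int (length c) - 2 + 1} = {}"
    using pcomp_le_length by (fastforce simp: Delta_comp_def face_dim_def osp_type_def)
  then show ?thesis
    unfolding chains_def by (simp only: subset_empty keys_eq_empty) auto
qed

lemma homology_class_top: "homology_class (Delta_comp n c) (int (length c) - 2) z = {z}"
  unfolding homology_class_eq boundaries_def chains_above_top by (simp add: boundary_zero)

text \<open>At the smaller index \<open>l\<close> of two different ones, one merged face has a block
  of size \<open>c ! l + c ! Suc l\<close>, the other a block of size \<open>c ! l\<close>;
  positivity tells them apart.\<close>

lemma merge_blocks_facets_inj:
  assumes C: "C \<in> facets" "C' \<in> facets" and i: "Suc i < length c" "Suc i' < length c"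
    and eq: "merge_blocks i C = merge_blocks i' C'"
  shows "i = i'"
proof -
  have nth: "card (merge_blocks l D ! m) = (if m = l then c ! l + c ! Suc l else c ! m)"
    if "D \<in> facets" "Suc l < length c" "m \<le> l" for D l m
  proof -
    have "card (D ! l \<union> D ! Suc l) = c ! l + c ! Suc l"
      using that by (subst card_Un_disjoint) (simp_all add: facet_finite facet_disjoint facet_card)
    then show ?thesis
      using that by (simp add: merge_blocks_def nth_append facet_length facet_card)
  qed
  have "0 < c ! Suc l" if "Suc l < length c" for l
    using that by (intro parts_pos) simp
  then show ?thesis
    using nth[of C i] nth[of C' i'] C i eq
    by (metis add_eq_self_zero less_or_eq_imp_le linorder_neqE_nat not_less_zero)
qed

text \<open>Only merges at \<open>i\<close> produce this face, so a single sign factors out. For a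
  cycle, the coefficients over each fibre of merging at \<open>i\<close> therefore add up to
  zero.\<close>

lemma lookup_boundary_merge_blocks:
  fixes z :: "'f::field chain"
  assumes z: "Poly_Mapping.keys z \<subseteq> facets" and C: "C \<in> facets" and i: "Suc i < length c"
  shows "Poly_Mapping.lookup (boundary z) (merge_blocks i C) =
    (- 1) ^ i * (\<Sum>D\<in>{D \<in> facets. merge_blocks i D = merge_blocks i C}. Poly_Mapping.lookup z D)"
proof -
  have face: "Poly_Mapping.lookup (face_boundary D :: 'f chain) (merge_blocks i C) =
      (if merge_blocks i D = merge_blocks i C then (- 1) ^ i else 0)" if D: "D \<in> facets" for D
  proof -
    have "Poly_Mapping.lookup (face_boundary D :: 'f chain) (merge_blocks i C) =
      (\<Sum>i'<length c - 1. if i' = i then (if merge_blocks i D = merge_blocks i C then (- 1) ^ i else 0) else 0)"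
      unfolding lookup_face_boundary facet_length[OF D]
    proof (rule sum.cong[OF refl])
      fix l assume "l \<in> {..<length c - 1}"
      then have "Suc l < length c"
        by simp
      from merge_blocks_facets_inj[OF D C this i]
      show "(if merge_blocks l D = merge_blocks i C then (- 1) ^ l else 0) =
          (if l = i then if merge_blocks i D = merge_blocks i C then (- 1) ^ i else 0 else 0 :: 'f)"
        by (cases "l = i") auto
    qed
    then show ?thesis
      using i by (simp add: less_diff_conv)
  qed
  have "Poly_Mapping.lookup (boundary z) (merge_blocks i C) = (\<Sum>D\<in>facets. Poly_Mapping.lookup z D *
      Poly_Mapping.lookup (face_boundary D) (merge_blocks i C))"
    by (simp add: boundary_superset[OF finite_facets z] lookup_sum)
  also have "\<dots> = (\<Sum>D\<in>facets. if merge_blocks i D = merge_blocks i C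
      then (- 1) ^ i * Poly_Mapping.lookup z D else 0)"
    by (rule sum.cong) (simp_all add: face mult.commute)
  also have "\<dots> = (\<Sum>D\<in>{D \<in> facets. merge_blocks i D = merge_blocks i C}.
      (- 1) ^ i * Poly_Mapping.lookup z D)"
    using finite_facets by (simp add: sum.inter_filter)
  finally show ?thesis
    by (simp add: sum_distrib_left)
qed

text \<open>\<open>D\<close> and \<open>C\<close> differ only in how they split the union of blocks
  \<open>i\<close> and \<open>i + 1\<close>. Block \<open>i + 1\<close> counts once more than block
  \<open>i\<close>, and \<open>C\<close> has the largest elements there.\<close>

lemma weight_merge_less:
  assumes C: "C \<in> facets" and D: "D \<in> facets" and i: "Suc i < length c"
    and less: "\<And>x y. x \<in> C ! i \<Longrightarrow> y \<in> C ! Suc i \<Longrightarrow> x < y"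
    and merge: "merge_blocks i D = merge_blocks i C" and neq: "D \<noteq> C"
  shows "weight D < weight C"
proof -
  have len: "length D = length c" "length C = length c"
    using C D by (simp_all add: facet_length)
  note eqs = merge_blocks_eqD[OF merge, unfolded len, OF refl i]
  let ?R = "{..<length c} - {i} - {Suc i}"
  \<comment> \<open>The share of the union is separated off, so that only
    \<open>\<Sum>(E ! Suc i)\<close> distinguishes the two faces.\<close>
  have weight: "weight E =
      i * \<Sum>(E ! i \<union> E ! Suc i) + \<Sum>(E ! Suc i) + (\<Sum>l\<in>?R. l * \<Sum>(E ! l))" if "E \<in> facets" for E
  proof -
    have "weight E = i * \<Sum>(E ! i) + (Suc i * \<Sum>(E ! Suc i) + (\<Sum>l\<in>?R. l * \<Sum>(E ! l)))"
      unfolding weight_def facet_length[OF that] using i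
      by (subst sum.remove[of _ i], simp, simp, subst sum.remove[of _ "Suc i"]) simp_all
    moreover have "\<Sum>(E ! i \<union> E ! Suc i) = \<Sum>(E ! i) + \<Sum>(E ! Suc i)"
      using that i by (intro sum.union_disjoint) (simp_all add: facet_finite facet_disjoint)
    ultimately show ?thesis
      by (simp add: algebra_simps)
  qed
  have "D ! Suc i \<noteq> C ! Suc i"
  proof
    assume eq: "D ! Suc i = C ! Suc i"
    moreover have "D ! i \<inter> D ! Suc i = {}" "C ! i \<inter> C ! Suc i = {}"
      using C D i by (simp_all add: facet_disjoint)
    ultimately have "D ! i = C ! i"
      using eqs(1) by blast
    then have "D = C"
      using eq eqs(2) len by (metis nth_equalityI)
    with neq show False ..
  qed
  moreover have "D ! Suc i \<subseteq> C ! i \<union> C ! Suc i"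
    using eqs(1) by blast
  moreover have "card (D ! Suc i) = card (C ! Suc i)"
    using C D i by (simp add: facet_card)
  ultimately have "\<Sum>(D ! Suc i) < \<Sum>(C ! Suc i)"
    using C i less by (intro sum_less_of_block_less[of "C ! i"]) (simp_all add: facet_finite)
  moreover have "(\<Sum>l\<in>?R. l * \<Sum>(D ! l)) = (\<Sum>l\<in>?R. l * \<Sum>(C ! l))"
    using eqs(2) by (intro sum.cong) auto
  ultimately show ?thesis
    by (simp add: weight[OF C] weight[OF D] eqs(1))
qed

text \<open>This serves spanning: by linearity, a cycle is determined by its coefficients at the
  faces of permutations with the given descents.\<close>

lemma cycle_zeroI:
  fixes z :: "'f::field chain"
  assumes z: "Poly_Mapping.keys z \<subseteq> facets" "boundary z = 0"
    and vanish: "\<And>\<alpha>. \<alpha> \<in> perms_with_descents n c \<Longrightarrow> Poly_Mapping.lookup z (osp_of_perm \<alpha> c) = 0"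
  shows "z = 0"
proof -
  have "Poly_Mapping.lookup z C = 0" if "C \<in> facets" for C
    using that
  proof (induction "weight C" arbitrary: C rule: less_induct)
    case less
    show ?case
    proof (cases "\<exists>\<alpha>\<in>perms_with_descents n c. osp_of_perm \<alpha> c = C")
      case True
      then show ?thesis
        using vanish by blast
    next
      case False
      then obtain i where i: "Suc i < length c" "\<And>x y. x \<in> C ! i \<Longrightarrow> y \<in> C ! Suc i \<Longrightarrow> x \<le> y"
        using facet_eq_osp_of_perm[OF less.prems] by (meson not_le)
      \<comment> \<open>Disjoint blocks share no element, so the weak inequality is strict.\<close>
      have lt: "x < y" if "x \<in> C ! i" "y \<in> C ! Suc i" for x y
        using i(2)[OF that] facet_disjoint[OF less.prems, of i "Suc i"] i(1) that
        by (cases "x = y") auto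
      let ?M = "{D \<in> facets. merge_blocks i D = merge_blocks i C}"
      have "0 = (- 1) ^ i * (\<Sum>D\<in>?M. Poly_Mapping.lookup z D)"
        using lookup_boundary_merge_blocks[OF z(1) less.prems i(1)] z(2) by simp
      then have "0 = (\<Sum>D\<in>?M. Poly_Mapping.lookup z D)"
        by simp
      \<comment> \<open>All other faces of the fibre are lighter, so their coefficients vanish by
        induction.\<close>
      also have "\<dots> = (\<Sum>D\<in>{C}. Poly_Mapping.lookup z D)"
      proof (rule sum.mono_neutral_right)
        show "\<forall>D\<in>?M - {C}. Poly_Mapping.lookup z D = 0"
        proof
          fix D assume "D \<in> ?M - {C}"
          then have D: "D \<in> facets" "merge_blocks i D = merge_blocks i C" "D \<noteq> C"
            by auto
          show "Poly_Mapping.lookup z D = 0"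
            by (rule less.hyps[OF weight_merge_less[OF less.prems D(1) i(1) lt D(2,3)] D(1)])
        qed
      qed (use finite_facets less.prems in auto)
      finally show ?thesis
        by simp
    qed
  qed
  then show ?thesis
    using z(1) by (intro poly_mapping_eqI) (metis in_keys_iff lookup_zero subsetD)
qed

text \<open>For each merge place \<open>i\<close>, right multiplication by the transposition at the
  row end \<open>p\<close> reverses the sign but fixes the merged face, since both moved positions
  lie in the merged block. The terms cancel in pairs.\<close>

lemma boundary_perm_cycle:
  assumes "\<alpha> permutes {1..n}"
  shows "boundary (perm_cycle n c \<alpha> :: 'f::field chain) = 0"
proof -
  let ?G = "column_group n c"
  define m :: "nat \<Rightarrow> (nat \<Rightarrow> nat) \<Rightarrow> 'f chain" where
    "m i \<gamma> = Poly_Mapping.single (merge_blocks i (osp_of_perm (\<alpha> \<circ> \<gamma>) c))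
      (of_int (sign \<gamma>) * (- 1) ^ i)" for i \<gamma>
  have "boundary (perm_cycle n c \<alpha> :: 'f chain) = (\<Sum>\<gamma>\<in>?G. \<Sum>i<length c - 1. m i \<gamma>)"
    by (simp add: perm_cycle_def boundary_sum boundary_single face_boundary_def chain_scale_sum
        m_def map_single)
  also have "\<dots> = (\<Sum>i<length c - 1. \<Sum>\<gamma>\<in>?G. m i \<gamma>)"
    by (rule sum.swap)
  also have "\<dots> = 0"
  proof (rule sum.neutral, rule ballI)
    fix i assume "i \<in> {..<length c - 1}"
    then have i: "Suc i < length c"
      by simp
    define p where "p = psum (Suc i)"
    define \<tau> where "\<tau> = transpose p (Suc p)"
    have p: "p \<in> partial_sums c"
      using i by (simp add: p_def psum_Suc_in_partial_sums)
    have \<tau>: "\<tau> permutes {1..n}"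
      unfolding \<tau>_def using p partial_sums_subset by (intro permutes_swap_id) auto
    have block: "\<tau> ` position_block c l = position_block c l"
      if "l < length c" "l \<noteq> i" "l \<noteq> Suc i" for l
    proof -
      have "p \<notin> position_block c l" "Suc p \<notin> position_block c l"
        using row_position_block[of l] that row_psum[OF i] row_Suc[OF p] by (auto simp: p_def)
      then show ?thesis
        by (simp add: \<tau>_def transpose_image_eq)
    qed
    have blocks: "\<tau> ` (position_block c i \<union> position_block c (Suc i)) =
        position_block c i \<union> position_block c (Suc i)"
    proof -
      have "p \<in> position_block c i" "Suc p \<in> position_block c (Suc i)"
        using i psum_strict_mono[of i "Suc i"] psum_strict_mono[of "Suc i" "Suc (Suc i)"]
        by (auto simp: position_block_psum p_def)
      then show ?thesis
        by (simp add: \<tau>_def transpose_image_eq)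
    qed
    have merge: "merge_blocks i (osp_of_perm (\<alpha> \<circ> (\<gamma> \<circ> \<tau>)) c) = merge_blocks i (osp_of_perm (\<alpha> \<circ> \<gamma>) c)"
      for \<gamma>
    proof -
      have "osp_of_perm (\<alpha> \<circ> (\<gamma> \<circ> \<tau>)) c ! l = osp_of_perm (\<alpha> \<circ> \<gamma>) c ! l"
        if "l < length c" "l \<noteq> i" "l \<noteq> Suc i" for l
      proof -
        have "\<alpha> ` \<gamma> ` \<tau> ` position_block c l = \<alpha> ` \<gamma> ` position_block c l"
          using block[OF that] by simp
        then show ?thesis
          using that by (simp add: image_image)
      qed
      moreover have "osp_of_perm (\<alpha> \<circ> (\<gamma> \<circ> \<tau>)) c ! i \<union> osp_of_perm (\<alpha> \<circ> (\<gamma> \<circ> \<tau>)) c ! Suc i =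
          osp_of_perm (\<alpha> \<circ> \<gamma>) c ! i \<union> osp_of_perm (\<alpha> \<circ> \<gamma>) c ! Suc i"
      proof -
        have "\<alpha> ` \<gamma> ` \<tau> ` (position_block c i \<union> position_block c (Suc i)) =
            \<alpha> ` \<gamma> ` (position_block c i \<union> position_block c (Suc i))"
          using blocks by simp
        then show ?thesis
          using i by (simp add: image_image image_Un)
      qed
      ultimately show ?thesis
        using i unfolding merge_blocks_def
        by (intro arg_cong2[of _ _ _ _ append] nth_equalityI) auto
    qed
    have anti: "m i \<gamma> + m i (\<gamma> \<circ> \<tau>) = 0" if "\<gamma> \<in> ?G" for \<gamma>
    proof -
      have "permutation \<gamma>" "permutation \<tau>"
        using column_group_permutes[OF that] \<tau> by (auto simp: permutation_permutes)
      then have "sign (\<gamma> \<circ> \<tau>) = - sign \<gamma>"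
        by (simp add: sign_compose) (simp add: \<tau>_def sign_swap_id)
      then show ?thesis
        by (simp add: m_def merge flip: single_add)
    qed
    \<comment> \<open>Splitting the column group into pairs, as \<open>x = - x\<close> would not suffice in characteristic 2.\<close>
    define G1 where "G1 = {\<gamma> \<in> ?G. \<gamma> p < \<gamma> (Suc p)}"
    define G2 where "G2 = {\<gamma> \<in> ?G. \<gamma> (Suc p) < \<gamma> p}"
    have "\<gamma> p < \<gamma> (Suc p) \<or> \<gamma> (Suc p) < \<gamma> p" if "\<gamma> \<in> ?G" for \<gamma>
      using permutes_inj[OF column_group_permutes[OF that]] by (metis injD linorder_neqE_nat n_not_Suc_n)
    then have G: "?G = G1 \<union> G2" "G1 \<inter> G2 = {}"
      by (auto simp: G1_def G2_def)
    \<comment> \<open>Right multiplication by the involution \<open>\<tau>\<close> swaps the values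
      at \<open>p\<close> and \<open>Suc p\<close>, hence exchanges \<open>G1\<close> and
      \<open>G2\<close>.\<close>
    have "(\<Sum>\<gamma>\<in>G2. m i \<gamma>) = (\<Sum>\<gamma>\<in>G1. m i (\<gamma> \<circ> \<tau>))"
      by (rule sum.reindex_bij_witness[of _ "\<lambda>\<gamma>. \<gamma> \<circ> \<tau>" "\<lambda>\<gamma>. \<gamma> \<circ> \<tau>"])
        (use p in \<open>auto simp: G1_def G2_def \<tau>_def comp_assoc intro: column_group_swap\<close>)
    then have "(\<Sum>\<gamma>\<in>?G. m i \<gamma>) = (\<Sum>\<gamma>\<in>G1. m i \<gamma> + m i (\<gamma> \<circ> \<tau>))"
      using G finite_column_group by (simp add: sum.union_disjoint sum.distrib)
    also have "\<dots> = 0"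
      using anti by (intro sum.neutral) (simp add: G1_def)
    finally show "(\<Sum>\<gamma>\<in>?G. m i \<gamma>) = 0" .
  qed
  finally show ?thesis .
qed

section \<open>The cycles of permutations and their leading coefficients\<close>

lemma perm_cycle_in_cycles:
  assumes "\<alpha> permutes {1..n}"
  shows "perm_cycle n c \<alpha> \<in> cycles (Delta_comp n c) (int (length c) - 2)"
proof -
  have "Poly_Mapping.keys (perm_cycle n c \<alpha>) \<subseteq> facets"
  proof -
    have "Poly_Mapping.keys (perm_cycle n c \<alpha>) \<subseteq> (\<Union>\<gamma>\<in>column_group n c. {osp_of_perm (\<alpha> \<circ> \<gamma>) c})"
      unfolding perm_cycle_def by (rule order_trans[OF keys_sum]) auto
    then show ?thesis
      using osp_of_perm_facet[OF permutes_compose[OF column_group_permutes assms]] by blast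
  qed
  then show ?thesis
    by (simp add: cycles_def chains_top boundary_perm_cycle[OF assms])
qed

text \<open>The identity contributes \<open>1\<close>; every other term sits at a face of larger
  weight and so contributes nothing here.\<close>

lemma lookup_perm_cycle_self:
  assumes \<alpha>: "\<alpha> \<in> perms_with_descents n c"
  shows "Poly_Mapping.lookup (perm_cycle n c \<alpha> :: 'f::field chain) (osp_of_perm \<alpha> c) = 1"
proof -
  have "Poly_Mapping.lookup (perm_cycle n c \<alpha> :: 'f chain) (osp_of_perm \<alpha> c) =
      (\<Sum>\<gamma>\<in>column_group n c. if \<gamma> = id then 1 else 0)"
    unfolding perm_cycle_def lookup_sum
    using weight_perm_less[OF \<alpha>] by (intro sum.cong) (fastforce simp: lookup_single when_def sign_id)+
  then show ?thesis
    using finite_column_group id_in_column_group by simp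
qed

text \<open>Some term of the cycle sits at the second face. It comes either from the identity, and
  injectivity gives equality, or from another element, which raises the weight.\<close>

lemma lookup_perm_cycle_nonzero:
  assumes \<alpha>: "\<alpha> \<in> perms_with_descents n c" and \<beta>: "\<beta> \<in> perms_with_descents n c"
    and nz: "Poly_Mapping.lookup (perm_cycle n c \<alpha> :: 'f::field chain) (osp_of_perm \<beta> c) \<noteq> 0"
  shows "\<alpha> = \<beta> \<or> weight (osp_of_perm \<alpha> c) < weight (osp_of_perm \<beta> c)"
proof -
  obtain \<gamma> where \<gamma>: "\<gamma> \<in> column_group n c" "osp_of_perm (\<alpha> \<circ> \<gamma>) c = osp_of_perm \<beta> c"
    using nz unfolding perm_cycle_def lookup_sum
    by (metis (no_types, lifting) lookup_single_not_eq sum.neutral)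
  show ?thesis
  proof (cases "\<gamma> = id")
    case True
    then show ?thesis
      using \<gamma> \<alpha> \<beta> inj_on_osp_of_perm by (auto dest: inj_onD)
  next
    case False
    then show ?thesis
      using weight_perm_less[OF \<alpha> \<gamma>(1)] \<gamma>(2) by simp
  qed
qed

end

section \<open>Independence and spanning of the cycles\<close>

theorem theorem6p6:
  fixes n :: nat and c :: "nat list"
  assumes "pointed_composition n c" and "last c > 0"
  defines "X \<equiv> Delta_comp n c" and "j \<equiv> int (length c) - 2"
  defines "g \<equiv> (perm_cycle n c :: (nat \<Rightarrow> nat) \<Rightarrow> 'f::field chain)"
  shows "(\<forall>\<alpha>\<in>perms_with_descents n c. g \<alpha> \<in> cycles X j) \<and>
    inj_on (\<lambda>\<alpha>. homology_class X j (g \<alpha>)) (perms_with_descents n c) \<and>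
    vectorspace.basis (class_ring :: 'f ring) (homology X j)
      ((\<lambda>\<alpha>. homology_class X j (g \<alpha>)) ` perms_with_descents n c)"
proof -
  \<comment> \<open>Only the last part of a pointed composition may be zero, and
    \<open>last c > 0\<close> excludes this.\<close>
  have "0 < x" if "x \<in> set c" for x
  proof (cases "x \<in> set (butlast c)")
    case True
    then show ?thesis
      using assms(1) by (auto simp: pointed_composition_def Suc_le_eq)
  next
    case False
    have "c = butlast c @ [last c]"
      using assms(1) by (simp add: pointed_composition_def)
    then have "x \<in> set (butlast c @ [last c])"
      using that by metis
    then show ?thesis
      using False assms(2) by simp
  qed
  then interpret positive_composition n c
    using assms(1) by unfold_locales (auto simp: pointed_composition_def)
  let ?D = "perms_with_descents n c"
  let ?A = "\<lambda>\<alpha> \<beta>. Poly_Mapping.lookup (g \<alpha>) (osp_of_perm \<beta> c)"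
  let ?w = "\<lambda>\<alpha>. weight (osp_of_perm \<alpha> c)"
  have cyc: "g \<alpha> \<in> cycles X j" if "\<alpha> \<in> ?D" for \<alpha>
    unfolding g_def X_def j_def
    by (rule perm_cycle_in_cycles) (use that in \<open>simp add: perms_with_descents_iff\<close>)
  have diag: "?A \<alpha> \<alpha> = 1" if "\<alpha> \<in> ?D" for \<alpha>
    using lookup_perm_cycle_self[OF that] by (simp add: g_def)
  have tri: "\<alpha> = \<beta> \<or> ?w \<alpha> < ?w \<beta>" if "\<alpha> \<in> ?D" "\<beta> \<in> ?D" "?A \<alpha> \<beta> \<noteq> 0" for \<alpha> \<beta>
    using that unfolding g_def by (rule lookup_perm_cycle_nonzero)
  have lookup_lincomb: "Poly_Mapping.lookup (\<Sum>\<alpha>\<in>?D. chain_scale (b \<alpha>) (g \<alpha>)) (osp_of_perm \<beta> c) =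
      (\<Sum>\<alpha>\<in>?D. b \<alpha> * ?A \<alpha> \<beta>)" for b \<beta>
    by (simp add: lookup_sum)
  have sum_cycle: "(\<Sum>\<alpha>\<in>S. chain_scale (b \<alpha>) (g \<alpha>)) \<in> cycles X j" if "S \<subseteq> ?D" for b S
    using that by (induction S rule: infinite_finite_induct) (auto simp: cycles_closed cyc)
  \<comment> \<open>There are no nonzero boundaries in this degree, so classes can be compared as
    chains.\<close>
  have class_eq: "homology_class X j z = {z}" for z
    unfolding X_def j_def by (rule homology_class_top)
  have indep: "\<forall>\<alpha>\<in>?D. b \<alpha> = 0"
    if "homology_class X j (\<Sum>\<alpha>\<in>?D. chain_scale (b \<alpha>) (g \<alpha>)) = homology_class X j 0" for b
  proof -
    have "(\<Sum>\<alpha>\<in>?D. chain_scale (b \<alpha>) (g \<alpha>)) = 0"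
      using that by (simp add: class_eq)
    then have "(\<Sum>\<alpha>\<in>?D. b \<alpha> * ?A \<alpha> \<beta>) = 0" for \<beta>
      by (simp flip: lookup_lincomb)
    with finite_perms_with_descents diag tri show ?thesis
      by (rule unitriangular_kernel)
  qed
  have span: "\<exists>b. homology_class X j z = homology_class X j (\<Sum>\<alpha>\<in>?D. chain_scale (b \<alpha>) (g \<alpha>))"
    if z: "z \<in> cycles X j" for z
  proof -
    \<comment> \<open>The coefficients make the combination agree with \<open>z\<close> at the faces
      of all permutations in \<open>?D\<close>; the difference is then a cycle to which
      \<open>cycle_zeroI\<close> applies.\<close>
    have "\<exists>b. \<forall>\<beta>\<in>?D. (\<Sum>\<alpha>\<in>?D. b \<alpha> * ?A \<alpha> \<beta>) = Poly_Mapping.lookup z (osp_of_perm \<beta> c)"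
      using finite_perms_with_descents diag tri by (rule unitriangular_solve)
    then obtain b where b: "\<forall>\<beta>\<in>?D. (\<Sum>\<alpha>\<in>?D. b \<alpha> * ?A \<alpha> \<beta>) = Poly_Mapping.lookup z (osp_of_perm \<beta> c)" ..
    let ?s = "\<Sum>\<alpha>\<in>?D. chain_scale (b \<alpha>) (g \<alpha>)"
    have "chain_scale (- 1) ?s = - ?s"
      by (rule poly_mapping_eqI) simp
    then have "z - ?s \<in> cycles X j"
      using cycles_closed(2)[OF z cycles_closed(3)[OF sum_cycle[OF order_refl]], of "- 1" b] by simp
    then have "Poly_Mapping.keys (z - ?s) \<subseteq> facets" "boundary (z - ?s) = 0"
      unfolding cycles_def X_def j_def chains_top by blast+
    then have "z - ?s = 0"
    proof (rule cycle_zeroI)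
      fix \<beta> assume "\<beta> \<in> ?D"
      then show "Poly_Mapping.lookup (z - ?s) (osp_of_perm \<beta> c) = 0"
        unfolding lookup_minus lookup_lincomb using b by simp
    qed
    then show ?thesis
      by auto
  qed
  show ?thesis
    using cyc homology_basisI[OF finite_perms_with_descents cyc indep span] by blast
qed

end
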